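(* Let $G$ be a Hausdorff strongly topological gyrogroup. Then the following conditions are equivalent: (1) $G$ is metrizable; (2) $G$ is Fréchet-Urysohn and has countable $cs^{*}$-character; (3) $G$ is Fréchet-Urysohn and has an $\omega^{\omega}$-base; (4) $G$ is feathered and has countable $cs^{*}$-character; (5) $G$ is feathered and has an $\omega^{\omega}$-base.
   Context: A gyrogroup is a nonempty set $G$ with a binary operation $\oplus$ such that: (G1) there is a unique identity element $0\in G$ with $0\oplus a=a=a\oplus 0$ for all $a\in G$; (G2) for each $x\in G$ there is a unique inverse $\ominus x\in G$ with $\ominus x\oplus x=0=x\oplus(\ominus x)$; (G3) for all $x,y\in G$ there is an automorphism $\mathrm{gyr}[x,y]$ of $(G,\oplus)$ with $x\oplus(y\oplus z)=(x\oplus y)\oplus \mathrm{gyr}[x,y](z)$ for all $z\in G$; (G4) $\mathrm{gyr}[x\oplus y,y]=\mathrm{gyr}[x,y]$ for all $x,y\in G$. A topological gyrogroup is a gyrogroup with a topology such that $\oplus:G\times G\to G$ is jointly continuous and $x\mapsto\ominus x$ is continuous. A topological gyrogroup $G$ is a strongly topological gyrogroup if there is a neighborhood base $\mathscr{U}$ of $0$ such that $\mathrm{gyr}[x,y](U)=U$ for every $U\in\mathscr{U}$ and all $x,y\in G$. A topological gyrogroup $G$ is feathered if it contains a nonempty compact set $K$ of countable character in $G$, i.e. there is a countable family of open sets containing $K$ such that every open set containing $K$ contains a member of the family. A space $X$ is Fréchet-Urysohn if for any $A\subseteq X$ and $x\in\overline{A}$ there is a sequence in $A$ converging to $x$. A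 family $\mathcal{N}$ of subsets of $X$ is a $cs^{*}$-network at $x\in X$ if for each sequence $(x_n)_{n\in\mathbb{N}}$ in $X$ converging to $x$ and each neighborhood $O_x$ of $x$ there is $N\in\mathcal{N}$ such that $x\in N\subset O_x$ and $\{n\in\mathbb{N}:x_n\in N\}$ is infinite. The $cs^{*}$-character of a topological gyrogroup $G$ is the least cardinality of a $cs^{*}$-network at the identity $0$; thus $G$ has countable $cs^*$-character iff it has a countable $cs^*$-network at $0$. $\mathbb{N}^{\mathbb{N}}$ is the set of all functions $\mathbb{N}\to\mathbb{N}$ with the partial order $f\le g$ iff $f(n)\le g(n)$ for all $n$. A space $X$ has an $\omega^{\omega}$-base if every point $x\in X$ has a base of neighborhoods of the form $\{U_\alpha(x):\alpha\in\mathbb{N}^{\mathbb{N}}\}$ with $U_\beta(x)\subset U_\alpha(x)$ whenever $\alpha\le\beta$. All topological spaces are assumed to be Hausdorff. *)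

theory Defs
  imports "HOL-Analysis.Analysis"
begin

text \<open>
  Operations are only constrained on the carrier.  The axioms determine \<open>gyr x y\<close> on the
  carrier (by left cancellation), so taking it as a parameter adds no structure; equality of
  gyrations is equality of their restrictions to the carrier.
\<close>

locale gyrogroup =
  fixes G :: "'a set"
    and add :: "'a \<Rightarrow> 'a \<Rightarrow> 'a" (infixl "\<oplus>" 65)
    and zero :: 'a
    and neg :: "'a \<Rightarrow> 'a"
    and gyr :: "'a \<Rightarrow> 'a \<Rightarrow> 'a \<Rightarrow> 'a"
  assumes add_closed: "\<lbrakk>x \<in> G; y \<in> G\<rbrakk> \<Longrightarrow> x \<oplus> y \<in> G"
    and zero_closed: "zero \<in> G"
    and zero_add: "x \<in> G \<Longrightarrow> zero \<oplus> x = x"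
    and add_zero: "x \<in> G \<Longrightarrow> x \<oplus> zero = x"
    and zero_unique: "\<lbrakk>e \<in> G; \<And>x. x \<in> G \<Longrightarrow> e \<oplus> x = x \<and> x \<oplus> e = x\<rbrakk> \<Longrightarrow> e = zero"
    and neg_closed: "x \<in> G \<Longrightarrow> neg x \<in> G"
    and neg_add: "x \<in> G \<Longrightarrow> neg x \<oplus> x = zero"
    and add_neg: "x \<in> G \<Longrightarrow> x \<oplus> neg x = zero"
    and neg_unique: "\<lbrakk>x \<in> G; y \<in> G; y \<oplus> x = zero; x \<oplus> y = zero\<rbrakk> \<Longrightarrow> y = neg x"
    and gyr_bij: "\<lbrakk>x \<in> G; y \<in> G\<rbrakk> \<Longrightarrow> bij_betw (gyr x y) G G"
    and gyr_add: "\<lbrakk>x \<in> G; y \<in> G; a \<in> G; b \<in> G\<rbrakk> \<Longrightarrow> gyr x y (a \<oplus> b) = gyr x y a \<oplus> gyr x y b"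
    and gyr_assoc: "\<lbrakk>x \<in> G; y \<in> G; z \<in> G\<rbrakk> \<Longrightarrow> x \<oplus> (y \<oplus> z) = (x \<oplus> y) \<oplus> gyr x y z"
    and gyr_loop: "\<lbrakk>x \<in> G; y \<in> G; z \<in> G\<rbrakk> \<Longrightarrow> gyr (x \<oplus> y) y z = gyr x y z"

text \<open>Neighbourhoods need not be open.\<close>

definition nbhd :: "'a topology \<Rightarrow> 'a \<Rightarrow> 'a set \<Rightarrow> bool"
  where "nbhd X x V \<longleftrightarrow> V \<subseteq> topspace X \<and> (\<exists>U. openin X U \<and> x \<in> U \<and> U \<subseteq> V)"

definition nbhd_base :: "'a topology \<Rightarrow> 'a \<Rightarrow> 'a set set \<Rightarrow> bool"
  where "nbhd_base X x \<B> \<longleftrightarrow>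
    (\<forall>V\<in>\<B>. nbhd X x V) \<and> (\<forall>W. nbhd X x W \<longrightarrow> (\<exists>V\<in>\<B>. V \<subseteq> W))"

locale topological_gyrogroup =
  gyrogroup "topspace X" add zero neg gyr
  for X :: "'a topology"
    and add :: "'a \<Rightarrow> 'a \<Rightarrow> 'a" (infixl "\<oplus>" 65)
    and zero :: 'a
    and neg :: "'a \<Rightarrow> 'a"
    and gyr :: "'a \<Rightarrow> 'a \<Rightarrow> 'a \<Rightarrow> 'a" +
  assumes continuous_add: "continuous_map (prod_topology X X) X (\<lambda>p. fst p \<oplus> snd p)"
    and continuous_neg: "continuous_map X X neg"

locale strongly_topological_gyrogroup = topological_gyrogroup +
  assumes gyr_invariant_base:
    "\<exists>\<U>. nbhd_base X zero \<U> \<and>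
      (\<forall>U\<in>\<U>. \<forall>x\<in>topspace X. \<forall>y\<in>topspace X. gyr x y ` U = U)"

definition feathered :: "'a topology \<Rightarrow> bool"
  where "feathered X \<longleftrightarrow>
    (\<exists>K. K \<noteq> {} \<and> compactin X K \<and>
      (\<exists>\<V>. countable \<V> \<and> (\<forall>V\<in>\<V>. openin X V \<and> K \<subseteq> V) \<and>
        (\<forall>W. openin X W \<and> K \<subseteq> W \<longrightarrow> (\<exists>V\<in>\<V>. V \<subseteq> W))))"

definition frechet_urysohn :: "'a topology \<Rightarrow> bool"
  where "frechet_urysohn X \<longleftrightarrow>
    (\<forall>A x. A \<subseteq> topspace X \<and> x \<in> X closure_of A \<longrightarrow>
      (\<exists>s :: nat \<Rightarrow> 'a. range s \<subseteq> A \<and> limitin X s x sequentially))"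

definition cs_star_network_at :: "'a topology \<Rightarrow> 'a \<Rightarrow> 'a set set \<Rightarrow> bool"
  where "cs_star_network_at X x \<N> \<longleftrightarrow>
    (\<forall>N\<in>\<N>. N \<subseteq> topspace X) \<and>
    (\<forall>(s :: nat \<Rightarrow> 'a) V. range s \<subseteq> topspace X \<and> limitin X s x sequentially \<and> nbhd X x V \<longrightarrow>
      (\<exists>N\<in>\<N>. x \<in> N \<and> N \<subseteq> V \<and> infinite {n. s n \<in> N}))"

text \<open>
  The \<open>cs\<^sup>*\<close>-character of a topological gyrogroup is the least cardinality of a
  \<open>cs\<^sup>*\<close>-network at the identity, which is the point to supply here.
\<close>

definition countable_cs_star_character_at :: "'a topology \<Rightarrow> 'a \<Rightarrow> bool"
  where "countable_cs_star_character_at X x \<longleftrightarrow> (\<exists>\<N>. countable \<N> \<and> cs_star_network_at X x \<N>)"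

text \<open>The order on \<^typ>\<open>nat \<Rightarrow> nat\<close> is the pointwise one.\<close>

definition has_omega_omega_base :: "'a topology \<Rightarrow> bool"
  where "has_omega_omega_base X \<longleftrightarrow>
    (\<forall>x\<in>topspace X. \<exists>U :: (nat \<Rightarrow> nat) \<Rightarrow> 'a set.
      nbhd_base X x (range U) \<and> (\<forall>\<alpha> \<beta>. \<alpha> \<le> \<beta> \<longrightarrow> U \<beta> \<subseteq> U \<alpha>))"

end

theory Submission
  imports Defs
begin

text \<open>
  Left translation turns the gyration-invariant neighbourhoods of the identity into a uniformity,
  so a countable base at the identity already gives a metric.  An \<open>\<omega>\<^sup>\<omega>\<close>-base yields a countable
  \<open>cs\<^sup>*\<close>-network, so it suffices to produce a countable base from such a network \<open>\<N>\<close>.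

  If every neighbourhood of the identity contains some \<open>N \<in> \<N>\<close> whose closure has an interior point,
  the sets of all \<open>\<ominus>a \<oplus> b\<close> with \<open>a, b\<close> in such closures form a base.  Otherwise any
  finitely many members of \<open>\<N>\<close> inside some neighbourhood avoid a dense open set, and a sequence that
  converges to the identity while running through these dense open sets contradicts the network
  property.

  In a Frechet-Urysohn gyrogroup such a sequence exists by an argument of Nyikos.  In the feathered
  case one chooses a compact subgyrogroup \<open>L\<close>, the intersection of a sequence of neighbourhoods, and
  cosets of \<open>L\<close> inside the dense open sets that converge to \<open>L\<close>.  Zorn's lemma lifts this convergent
  sequence of cosets along ever smaller compact subgyrogroups until they are points.
\<close>

section \<open>Metrization by a sequence of entourages\<close>

text \<open>
  Frink's argument: cut a chain of total length \<open>S\<close> at the link where the partial sums pass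
  \<open>S / 2\<close>; by induction both remaining pieces span distance at most \<open>S\<close>.
\<close>

lemma quasi_triangle_chain:
  fixes f :: "'a \<Rightarrow> 'a \<Rightarrow> real"
  assumes nonneg: "\<And>x y. 0 \<le> f x y"
    and refl: "\<And>x. x \<in> M \<Longrightarrow> f x x = 0"
    and quasi: "\<And>x y z w c. \<lbrakk>x \<in> M; y \<in> M; z \<in> M; w \<in> M; f x y \<le> c; f y z \<le> c; f z w \<le> c\<rbrakk>
      \<Longrightarrow> f x w \<le> 2 * c"
    and p: "\<And>i. i \<le> n \<Longrightarrow> p i \<in> M"
  shows "f (p 0) (p n) \<le> 2 * (\<Sum>i<n. f (p i) (p (Suc i)))"
  using p
proof (induction n arbitrary: p rule: less_induct)
  case (less n)
  define S where "S k = (\<Sum>i<k. f (p i) (p (Suc i)))" for k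
  have S0: "0 \<le> S k" for k
    unfolding S_def by (simp add: nonneg sum_nonneg)
  show ?case
  proof (cases "n = 0")
    case True
    then show ?thesis using refl less.prems by simp
  next
    case False
    define k where "k = Max {k. k < n \<and> S k \<le> S n / 2}"
    have "finite {k. k < n \<and> S k \<le> S n / 2}" by simp
    moreover have ne: "0 \<in> {k. k < n \<and> S k \<le> S n / 2}"
      using False S0[of n] by (simp add: S_def)
    ultimately have k: "k < n" "S k \<le> S n / 2" and kmax: "\<And>j. \<lbrakk>j < n; S j \<le> S n / 2\<rbrakk> \<Longrightarrow> j \<le> k"
      unfolding k_def using Max_in[of "{k. k < n \<and> S k \<le> S n / 2}"] Max_ge by blast+
    define m where "m = n - Suc k"
    have n: "n = Suc k + m" using k m_def by simp
    have split: "S (j + m) = S j + (\<Sum>i<m. f (p (j + i)) (p (Suc (j + i))))" for j m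
      by (induction m) (auto simp: S_def)
    have tail: "(\<Sum>i<m. f (p (Suc k + i)) (p (Suc (Suc k + i)))) \<le> S n / 2"
    proof (cases "m = 0")
      case True
      then show ?thesis using S0[of n] by simp
    next
      case False
      then have "\<not> S (Suc k) \<le> S n / 2" using kmax[of "Suc k"] n by auto
      then show ?thesis using split[of "Suc k" m] n by simp
    qed
    have 1: "f (p 0) (p k) \<le> S n"
      using less.IH[of k p] k less.prems by (simp add: S_def)
    have 2: "f (p k) (p (Suc k)) \<le> S n"
    proof -
      have "f (p k) (p (Suc k)) = S (Suc k) - S k" by (simp add: S_def)
      moreover have "S (Suc k) \<le> S n"
        using split[of "Suc k" m] n nonneg by (simp add: sum_nonneg)
      ultimately show ?thesis using S0[of k] by simp
    qed
    have 3: "f (p (Suc k)) (p n) \<le> S n"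
      using less.IH[of m "\<lambda>i. p (Suc k + i)"] n less.prems tail by simp
    show ?thesis
      using quasi[OF _ _ _ _ 1 2 3] less.prems k by (simp add: S_def)
  qed
qed

text \<open>Infima of chain sums satisfy the triangle inequality by concatenation of chains.
  \<open>quasi_triangle_chain\<close> bounds every chain sum below by \<open>f x y / 2\<close>, and
  the one-link chain bounds the infimum above by \<open>f x y\<close>, so it still separates
  points.\<close>

lemma metric_of_quasi_metric:
  fixes f :: "'a \<Rightarrow> 'a \<Rightarrow> real"
  assumes nonneg: "\<And>x y. 0 \<le> f x y"
    and sym: "\<And>x y. \<lbrakk>x \<in> M; y \<in> M\<rbrakk> \<Longrightarrow> f x y = f y x"
    and zero_iff: "\<And>x y. \<lbrakk>x \<in> M; y \<in> M\<rbrakk> \<Longrightarrow> f x y = 0 \<longleftrightarrow> x = y"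
    and quasi: "\<And>x y z w c. \<lbrakk>x \<in> M; y \<in> M; z \<in> M; w \<in> M; f x y \<le> c; f y z \<le> c; f z w \<le> c\<rbrakk>
      \<Longrightarrow> f x w \<le> 2 * c"
  obtains d where "Metric_space M d"
    and "\<And>x y. \<lbrakk>x \<in> M; y \<in> M\<rbrakk> \<Longrightarrow> d x y \<le> f x y \<and> f x y \<le> 2 * d x y"
proof -
  define C where "C x y = {s. \<exists>n p. p 0 = x \<and> p n = y \<and> (\<forall>i\<le>n. p i \<in> M) \<and>
    s = (\<Sum>i<n. f (p i) (p (Suc i)))}" for x y
  \<comment> \<open>The locale \<open>Metric_space\<close> demands nonnegativity and symmetry on the
    whole type, hence the default 0 off \<open>M\<close>.\<close>
  define d where "d x y = (if x \<in> M \<and> y \<in> M then Inf (C x y) else 0)" for x y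
  have C_nonneg: "0 \<le> s" if s_in: "s \<in> C x y" for s x y
    using that nonneg unfolding C_def by (auto intro: sum_nonneg)
  have bdd: "bdd_below (C x y)" for x y
    using C_nonneg by (meson bdd_below.I)
  have f_in_C: "f x y \<in> C x y" if "x \<in> M" "y \<in> M" for x y
  proof -
    define p where "p i = (if i = 0 then x else y)" for i :: nat
    have "p 0 = x" "p 1 = y" "\<forall>i\<le>1. p i \<in> M" "f x y = (\<Sum>i<1. f (p i) (p (Suc i)))"
      using that by (auto simp: p_def)
    then show ?thesis unfolding C_def by blast
  qed
  have C_lower: "f x y / 2 \<le> s" if s_in: "s \<in> C x y" for s x y
  proof -
    obtain n p where p: "p 0 = x" "p n = y" "\<forall>i\<le>n. p i \<in> M" "s = (\<Sum>i<n. f (p i) (p (Suc i)))"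
      using s_in unfolding C_def by blast
    have "f (p 0) (p n) \<le> 2 * (\<Sum>i<n. f (p i) (p (Suc i)))"
      by (rule quasi_triangle_chain[where M = M]) (use nonneg zero_iff quasi p in auto)
    then show ?thesis using p by simp
  qed
  have C_trans: "s + t \<in> C x z" if "s \<in> C x y" "t \<in> C y z" for s t x y z
  proof -
    obtain n p where p: "p 0 = x" "p n = y" "\<forall>i\<le>n. p i \<in> M" "s = (\<Sum>i<n. f (p i) (p (Suc i)))"
      using \<open>s \<in> C x y\<close> unfolding C_def by blast
    obtain m q where q: "q 0 = y" "q m = z" "\<forall>i\<le>m. q i \<in> M" "t = (\<Sum>i<m. f (q i) (q (Suc i)))"
      using \<open>t \<in> C y z\<close> unfolding C_def by blast
    define r where "r i = (if i \<le> n then p i else q (i - n))" for i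
    have sum_r: "(\<Sum>i<n + k. f (r i) (r (Suc i))) = s + (\<Sum>i<k. f (q i) (q (Suc i)))" for k
    proof (induction k)
      case 0
      have "(\<Sum>i<n. f (r i) (r (Suc i))) = (\<Sum>i<n. f (p i) (p (Suc i)))"
        by (rule sum.cong) (auto simp: r_def)
      then show ?case using p by simp
    next
      case (Suc k)
      have "r (n + k) = q k" "r (Suc (n + k)) = q (Suc k)"
        using p q by (auto simp: r_def)
      then show ?case using Suc by simp
    qed
    have "r 0 = x" using p by (simp add: r_def)
    moreover have "r (n + m) = z" using p q by (auto simp: r_def)
    moreover have "\<forall>i\<le>n + m. r i \<in> M" using p q by (auto simp: r_def)
    moreover have "s + t = (\<Sum>i<n + m. f (r i) (r (Suc i)))" using sum_r[of m] q by simp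
    ultimately show ?thesis
      unfolding C_def by blast
  qed
  have C_sym: "s \<in> C y x" if s_in: "s \<in> C x y" for s x y
  proof -
    obtain n p where p: "p 0 = x" "p n = y" "\<forall>i\<le>n. p i \<in> M" "s = (\<Sum>i<n. f (p i) (p (Suc i)))"
      using s_in unfolding C_def by blast
    have "s = (\<Sum>i<n. f (p (n - Suc i)) (p (Suc (n - Suc i))))"
      using p by (simp add: sum.nat_diff_reindex[of "\<lambda>i. f (p i) (p (Suc i))" n])
    also have "\<dots> = (\<Sum>i<n. f (p (n - i)) (p (n - Suc i)))"
      by (rule sum.cong) (use p sym in \<open>auto simp: Suc_diff_Suc\<close>)
    finally have "s = (\<Sum>i<n. f (p (n - i)) (p (n - Suc i)))" .
    then show ?thesis
      unfolding C_def using p by (auto intro!: exI[of _ n] exI[of _ "\<lambda>i. p (n - i)"])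
  qed
  have C_ne: "C x y \<noteq> {}" if "x \<in> M" "y \<in> M" for x y
    using f_in_C[OF that] by auto
  have upper: "d x y \<le> f x y" if "x \<in> M" "y \<in> M" for x y
    using that f_in_C bdd by (simp add: d_def cInf_lower)
  have lower: "f x y / 2 \<le> d x y" if "x \<in> M" "y \<in> M" for x y
  proof -
    have "f x y / 2 \<le> Inf (C x y)" by (rule cInf_greatest) (use that C_ne C_lower in auto)
    then show ?thesis using that by (simp add: d_def)
  qed
  have "Metric_space M d"
  proof
    show "0 \<le> d x y" for x y
      using C_nonneg C_ne by (auto simp: d_def intro: cInf_greatest)
    show "d x y = d y x" for x y
    proof -
      have "C x y = C y x" using C_sym by blast
      then show ?thesis by (auto simp: d_def)
    qed
    show "d x y = 0 \<longleftrightarrow> x = y" if "x \<in> M" "y \<in> M" for x y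
    proof
      assume "d x y = 0"
      then have "f x y \<le> 0" using lower[OF that] by simp
      then show "x = y" using nonneg[of x y] zero_iff[OF that] by simp
    next
      assume "x = y"
      then have "f x y = 0" using zero_iff that by simp
      then show "d x y = 0" using lower[OF that] upper[OF that] by simp
    qed
    show "d x z \<le> d x y + d y z" if M: "x \<in> M" "y \<in> M" "z \<in> M" for x y z
    proof -
      have *: "d x z \<le> s + t" if "s \<in> C x y" "t \<in> C y z" for s t
        using C_trans[OF that] M bdd by (simp add: d_def cInf_lower)
      have "d x z - t \<le> d x y" if "t \<in> C y z" for t
      proof -
        have "d x z - t \<le> Inf (C x y)"
          by (rule cInf_greatest) (use C_ne M * that in \<open>auto simp: algebra_simps\<close>)
        then show ?thesis using M by (simp add: d_def)
      qed
      then have "d x z - d x y \<le> Inf (C y z)"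
        by (intro cInf_greatest) (use C_ne M in \<open>auto simp: algebra_simps\<close>)
      then show ?thesis using M by (simp add: d_def)
    qed
  qed
  then show ?thesis
    using that[of d] upper lower by fastforce
qed

text \<open>Each step absorbs a composition of three entourages, because Frink's inequality is about
  three consecutive links. The quasi-metric is a power of 1/2 whose exponent is the first index at
  which two points are told apart.\<close>

lemma metrizable_space_entourages:
  fixes E :: "nat \<Rightarrow> 'a \<Rightarrow> 'a set"
  assumes refl: "\<And>n x. x \<in> topspace X \<Longrightarrow> x \<in> E n x"
    and sym: "\<And>n x y. \<lbrakk>x \<in> topspace X; y \<in> topspace X; y \<in> E n x\<rbrakk> \<Longrightarrow> x \<in> E n y"
    and comp: "\<And>n x y z w. \<lbrakk>x \<in> topspace X; y \<in> topspace X; z \<in> topspace X; w \<in> topspace X;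
      y \<in> E (Suc n) x; z \<in> E (Suc n) y; w \<in> E (Suc n) z\<rbrakk> \<Longrightarrow> w \<in> E n x"
    and separating: "\<And>x y. \<lbrakk>x \<in> topspace X; y \<in> topspace X; \<And>n. y \<in> E n x\<rbrakk> \<Longrightarrow> x = y"
    and openin_iff: "\<And>U. openin X U \<longleftrightarrow> U \<subseteq> topspace X \<and> (\<forall>x\<in>U. \<exists>n. E n x \<inter> topspace X \<subseteq> U)"
  shows "metrizable_space X"
proof -
  define M where "M = topspace X"
  have anti_step: "y \<in> E n x" if "y \<in> E (Suc n) x" "x \<in> M" "y \<in> M" for x y n
    using comp[of x y y y n] refl[of y "Suc n"] that by (simp add: M_def)
  have anti: "y \<in> E n x" if "n \<le> m" "y \<in> E m x" "x \<in> M" "y \<in> M" for x y n m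
    using that(1) that(2)
  proof (induction m rule: dec_induct)
    case base then show ?case .
  next
    case (step m)
    then show ?case using anti_step that by blast
  qed
  \<comment> \<open>The value 1 records that \<open>y\<close> already leaves \<open>E 0 x\<close>,
    which need not be the whole space; hence membership in \<open>E n x\<close> corresponds to the
    bound \<open>(1/2) ^ Suc n\<close>.\<close>
  define f :: "'a \<Rightarrow> 'a \<Rightarrow> real" where
    "f x y = (if \<forall>n. y \<in> E n x then 0 else (1/2) ^ (LEAST n. y \<notin> E n x))" for x y
  have f_le: "f x y \<le> (1/2) ^ Suc n \<longleftrightarrow> y \<in> E n x" if "x \<in> M" "y \<in> M" for x y n
  proof (cases "\<forall>n. y \<in> E n x")
    case True
    then show ?thesis by (simp add: f_def)
  next
    case False
    define k where "k = (LEAST n. y \<notin> E n x)"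
    have "y \<notin> E k x" unfolding k_def using False by (metis (mono_tags, lifting) LeastI)
    moreover have "y \<in> E j x" if "j < k" for j using that not_less_Least unfolding k_def by blast
    ultimately have "y \<in> E n x \<longleftrightarrow> Suc n \<le> k"
      using anti[of k n y x] that by (meson not_less_eq_eq Suc_le_eq)
    moreover have "f x y = (1/2) ^ k" using False by (simp add: f_def k_def)
    moreover have "(1/2 :: real) ^ k \<le> (1/2) ^ Suc n \<longleftrightarrow> Suc n \<le> k"
      by (rule power_decreasing_iff) auto
    ultimately show ?thesis by simp
  qed
  have f_cases: "f x y = 0 \<or> (\<exists>k. f x y = (1/2) ^ k)" for x y
    unfolding f_def by (cases "\<forall>n. y \<in> E n x") auto
  have f_nonneg: "0 \<le> f x y" for x y
    by (simp add: f_def)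
  have f_le1: "f x y \<le> 1" for x y
    by (simp add: f_def power_le_one)
  have f_zero: "f x y = 0 \<longleftrightarrow> x = y" if "x \<in> M" "y \<in> M" for x y
    using that refl separating[of x y] by (auto simp: f_def M_def)
  have f_sym: "f x y = f y x" if "x \<in> M" "y \<in> M" for x y
  proof -
    have "y \<in> E n x \<longleftrightarrow> x \<in> E n y" for n using sym that by (auto simp: M_def)
    then show ?thesis by (simp add: f_def)
  qed
  have quasi: "f x w \<le> 2 * c"
    if M: "x \<in> M" "y \<in> M" "z \<in> M" "w \<in> M" and le: "f x y \<le> c" "f y z \<le> c" "f z w \<le> c" for x y z w c
  proof -
    \<comment> \<open>Replacing the arbitrary bound \<open>c\<close> by an attained maximum leaves
      only 0 and powers of 1/2. For 1 and 1/2 the bound \<open>f \<le> 1\<close> suffices; from 1/4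
      on, \<open>comp\<close> applies.\<close>
    define m where "m = max (f x y) (max (f y z) (f z w))"
    have m: "f x y \<le> m" "f y z \<le> m" "f z w \<le> m" "m \<le> c" using le by (auto simp: m_def)
    have "m = 0 \<or> (\<exists>k. m = (1/2) ^ k)"
      using f_cases[of x y] f_cases[of y z] f_cases[of z w] unfolding m_def max_def by presburger
    then consider "m = 0" | "m = 1" | "m = 1/2" | j where "m = (1/2) ^ Suc (Suc j)"
    proof (elim disjE exE)
      fix k assume "m = (1/2) ^ k"
      then show ?thesis
      proof (cases k rule: nat.exhaust[case_names 0 Suc])
        case (Suc j)
        then show ?thesis using that(3) that(4)[of "j - 1"] \<open>m = (1/2) ^ k\<close> by (cases j) auto
      qed (use that(2) \<open>m = (1/2) ^ k\<close> in auto)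
    qed
    then have "f x w \<le> 2 * m"
    proof cases
      case 1
      then have "f x y = 0" "f y z = 0" "f z w = 0" using m f_nonneg by (metis order_antisym)+
      then have "x = y" "y = z" "z = w" using f_zero M by blast+
      then show ?thesis using f_zero[of w w] M 1 by simp
    next
      case 2
      then show ?thesis using f_le1[of x w] by simp
    next
      case 3
      then show ?thesis using f_le1[of x w] by simp
    next
      case 4
      then have "y \<in> E (Suc j) x" "z \<in> E (Suc j) y" "w \<in> E (Suc j) z"
        using f_le[of x y "Suc j"] f_le[of y z "Suc j"] f_le[of z w "Suc j"] m(1-3) M
        by (simp_all del: power_Suc)
      then have "w \<in> E j x" using comp[of x y z w j] M by (simp add: M_def)
      then show ?thesis using f_le[of x w j] M(1,4) 4 by simp
    qed
    then show ?thesis using m by simp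
  qed
  obtain d where d: "Metric_space M d" and df: "\<And>x y. \<lbrakk>x \<in> M; y \<in> M\<rbrakk> \<Longrightarrow> d x y \<le> f x y \<and> f x y \<le> 2 * d x y"
  proof (rule metric_of_quasi_metric[of f M])
    show "f x w \<le> 2 * c"
      if "x \<in> M" "y \<in> M" "z \<in> M" "w \<in> M" "f x y \<le> c" "f y z \<le> c" "f z w \<le> c" for x y z w c
      using quasi that .
  qed (use f_nonneg f_sym f_zero in auto)
  interpret Metric_space M d by (rule d)
  have small: "\<exists>n. (1/2 :: real) ^ Suc n < r" if r0: "r > 0" for r
  proof -
    obtain n where "(1/2 :: real) ^ n < r" using real_arch_pow_inv[of r "1/2"] r0 by auto
    moreover have "(1/2 :: real) ^ Suc n \<le> (1/2) ^ n" by simp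
    ultimately show ?thesis by (meson order_le_less_trans)
  qed
  have "openin mtopology U \<longleftrightarrow> openin X U" for U
  proof -
    \<comment> \<open>The two halves of \<open>df\<close> serve the two inclusions:
      \<open>f \<le> 2 * d\<close> here, at the cost of one more halving of the radius, and
      \<open>d \<le> f\<close> in \<open>in_ball\<close>.\<close>
    have ball_in: "\<exists>r>0. mball x r \<subseteq> E n x \<inter> M" if "x \<in> M" for x n
    proof (intro exI conjI subsetI)
      show "(0::real) < (1/2) ^ Suc (Suc n)" by simp
      fix y assume "y \<in> mball x ((1/2) ^ Suc (Suc n))"
      then have y: "y \<in> M" "d x y < (1/2) ^ Suc (Suc n)" by auto
      then have "f x y \<le> (1/2) ^ Suc n" using df[of x y] that by simp
      then show "y \<in> E n x \<inter> M" using f_le that y by simp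
    qed
    have in_ball: "\<exists>n. E n x \<inter> M \<subseteq> mball x r" if "x \<in> M" and r0: "r > 0" for x r
    proof -
      obtain n where n: "(1/2 :: real) ^ Suc n < r" using small[OF r0] by blast
      have "E n x \<inter> M \<subseteq> mball x r"
      proof
        fix y assume y: "y \<in> E n x \<inter> M"
        then have "f x y < r" using f_le[of x y n] n that by force
        then show "y \<in> mball x r" using y df[of x y] that by simp
      qed
      then show ?thesis ..
    qed
    show ?thesis
      unfolding openin_mtopology openin_iff M_def[symmetric]
      using ball_in in_ball by (meson subsetD subset_trans)
  qed
  then have "X = mtopology" by (simp add: topology_eq)
  then show ?thesis using metrizable_space_mtopology by simp
qed

section \<open>First countability, networks and compact chains\<close>

lemma first_countable_decseq_base:
  assumes "first_countable X" "x \<in> topspace X"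
  obtains B :: "nat \<Rightarrow> 'a set" where "\<And>n. openin X (B n)" "\<And>n. x \<in> B n" "decseq B"
    "\<And>W. \<lbrakk>openin X W; x \<in> W\<rbrakk> \<Longrightarrow> \<exists>n. B n \<subseteq> W"
proof -
  obtain \<B> where \<B>: "countable \<B>" "\<And>V. V \<in> \<B> \<Longrightarrow> openin X V"
    "\<And>W. \<lbrakk>openin X W; x \<in> W\<rbrakk> \<Longrightarrow> \<exists>V\<in>\<B>. x \<in> V \<and> V \<subseteq> W"
    using assms unfolding first_countable_def by meson
  define \<C> where "\<C> = {V \<in> \<B>. x \<in> V}"
  have "\<C> \<noteq> {}" using \<B>(3)[of "topspace X"] assms(2) by (auto simp: \<C>_def)
  moreover have "countable \<C>" using \<B>(1) by (simp add: \<C>_def)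
  ultimately have from_in: "from_nat_into \<C> n \<in> \<C>"
    and from_surj: "V \<in> \<C> \<Longrightarrow> \<exists>n. from_nat_into \<C> n = V" for n V
    by (auto simp: from_nat_into intro: from_nat_into_surj)
  define B where "B n = (\<Inter>i\<le>n. from_nat_into \<C> i)" for n
  show ?thesis
  proof
    show "openin X (B n)" for n
      unfolding B_def using from_in \<B>(2) by (intro openin_Inter) (auto simp: \<C>_def)
    show "x \<in> B n" for n using from_in by (auto simp: B_def \<C>_def)
    show "decseq B" by (rule decseq_SucI) (auto simp: B_def)
    show "\<exists>n. B n \<subseteq> W" if W: "openin X W" "x \<in> W" for W
    proof -
      obtain V where V: "V \<in> \<C>" "V \<subseteq> W" using \<B>(3)[OF W] by (auto simp: \<C>_def)
      then obtain n where "from_nat_into \<C> n = V" using from_surj by blast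
      then have "B n \<subseteq> W" using V by (auto simp: B_def)
      then show ?thesis ..
    qed
  qed
qed

lemma limitin_if_decseq_base:
  assumes x: "x \<in> topspace X" and "decseq B" and base: "\<And>W. \<lbrakk>openin X W; x \<in> W\<rbrakk> \<Longrightarrow> \<exists>n. B n \<subseteq> W"
    and s: "\<And>n. s n \<in> B n"
  shows "limitin X s x sequentially"
  unfolding limitin_sequentially
proof (intro conjI allI impI)
  fix W assume "openin X W \<and> x \<in> W"
  then obtain n where "B n \<subseteq> W" using base by blast
  then show "\<exists>N. \<forall>m\<ge>N. s m \<in> W" using s \<open>decseq B\<close> unfolding decseq_def by blast
qed (rule x)

lemma first_countable_imp_frechet_urysohn:
  assumes "first_countable X" shows "frechet_urysohn X"
  unfolding frechet_urysohn_def
proof (intro allI impI)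
  fix A x assume A: "A \<subseteq> topspace X \<and> x \<in> X closure_of A"
  then have x: "x \<in> topspace X" by (simp add: in_closure_of)
  obtain B :: "nat \<Rightarrow> 'a set" where B: "\<And>n. openin X (B n)" "\<And>n. x \<in> B n" "decseq B"
    "\<And>W. \<lbrakk>openin X W; x \<in> W\<rbrakk> \<Longrightarrow> \<exists>n. B n \<subseteq> W"
    using first_countable_decseq_base[OF assms x] by blast
  have "\<exists>y. y \<in> A \<and> y \<in> B n" for n using A B(1,2) unfolding in_closure_of by blast
  then obtain s where s: "\<And>n. s n \<in> A" "\<And>n. s n \<in> B n" by metis
  have "limitin X s x sequentially" by (rule limitin_if_decseq_base[OF x B(3,4) s(2)])
  then show "\<exists>s :: nat \<Rightarrow> 'a. range s \<subseteq> A \<and> limitin X s x sequentially"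
    using s(1) by (intro exI[of _ s]) auto
qed

lemma first_countable_imp_countable_cs_star_character:
  assumes "first_countable X" "x \<in> topspace X" shows "countable_cs_star_character_at X x"
proof -
  obtain B :: "nat \<Rightarrow> 'a set" where B: "\<And>n. openin X (B n)" "\<And>n. x \<in> B n" "decseq B"
    "\<And>W. \<lbrakk>openin X W; x \<in> W\<rbrakk> \<Longrightarrow> \<exists>n. B n \<subseteq> W"
    using first_countable_decseq_base[OF assms] by blast
  have "cs_star_network_at X x (range B)"
    unfolding cs_star_network_at_def
  proof (intro conjI ballI allI impI)
    show "N \<subseteq> topspace X" if "N \<in> range B" for N using that B(1) openin_subset by blast
  next
    fix s :: "nat \<Rightarrow> 'a" and V
    assume s: "range s \<subseteq> topspace X \<and> limitin X s x sequentially \<and> nbhd X x V"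
    then obtain W where "openin X W" "x \<in> W" "W \<subseteq> V" unfolding nbhd_def by blast
    then obtain n where n: "B n \<subseteq> V" using B(4)[of W] by blast
    have "\<forall>\<^sub>F k in sequentially. s k \<in> B n" using s B(1,2) unfolding limitin_def by blast
    then have "\<exists>\<^sub>F k in sequentially. s k \<in> B n" by (rule eventually_frequently[rotated]) simp
    then have "infinite {k. s k \<in> B n}"
      by (simp add: cofinite_eq_sequentially[symmetric] frequently_cofinite)
    then show "\<exists>N\<in>range B. x \<in> N \<and> N \<subseteq> V \<and> infinite {n. s n \<in> N}" using n B(2) by blast
  qed
  then show ?thesis unfolding countable_cs_star_character_at_def by (intro exI[of _ "range B"]) simp
qed

lemma first_countable_imp_omega_omega_base:
  assumes "first_countable X" shows "has_omega_omega_base X"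
  unfolding has_omega_omega_base_def
proof
  fix x assume x: "x \<in> topspace X"
  obtain B :: "nat \<Rightarrow> 'a set" where B: "\<And>n. openin X (B n)" "\<And>n. x \<in> B n" "decseq B"
    "\<And>W. \<lbrakk>openin X W; x \<in> W\<rbrakk> \<Longrightarrow> \<exists>n. B n \<subseteq> W"
    using first_countable_decseq_base[OF assms x] by blast
  \<comment> \<open>Only the value at 0 is read: constant functions then reach every
    \<open>B n\<close>, and monotonicity is that of \<open>B\<close>.\<close>
  define U where "U \<alpha> = B (\<alpha> 0)" for \<alpha> :: "nat \<Rightarrow> nat"
  have "nbhd X x (U \<alpha>)" for \<alpha>
    using B(1,2) openin_subset unfolding nbhd_def U_def by blast
  moreover have "\<exists>\<alpha>. U \<alpha> \<subseteq> W" if W: "nbhd X x W" for W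
  proof -
    obtain V where "openin X V" "x \<in> V" "V \<subseteq> W" using W unfolding nbhd_def by blast
    then obtain n where "B n \<subseteq> W" using B(4)[of V] by blast
    then show ?thesis by (intro exI[of _ "\<lambda>_. n"]) (simp add: U_def)
  qed
  ultimately have "nbhd_base X x (range U)" unfolding nbhd_base_def by simp
  moreover have "U \<beta> \<subseteq> U \<alpha>" if "\<alpha> \<le> \<beta>" for \<alpha> \<beta>
    using that B(3) unfolding U_def decseq_def le_fun_def by blast
  ultimately show "\<exists>U :: (nat \<Rightarrow> nat) \<Rightarrow> 'a set. nbhd_base X x (range U) \<and> (\<forall>\<alpha> \<beta>. \<alpha> \<le> \<beta> \<longrightarrow> U \<beta> \<subseteq> U \<alpha>)"
    by blast
qed

lemma first_countable_imp_feathered: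
  assumes "first_countable X" "topspace X \<noteq> {}" shows "feathered X"
proof -
  obtain x where x: "x \<in> topspace X" using assms(2) by blast
  obtain B :: "nat \<Rightarrow> 'a set" where B: "\<And>n. openin X (B n)" "\<And>n. x \<in> B n" "decseq B"
    "\<And>W. \<lbrakk>openin X W; x \<in> W\<rbrakk> \<Longrightarrow> \<exists>n. B n \<subseteq> W"
    using first_countable_decseq_base[OF assms(1) x] by blast
  have "\<forall>V\<in>range B. openin X V \<and> {x} \<subseteq> V" using B(1,2) by blast
  moreover have "\<forall>W. openin X W \<and> {x} \<subseteq> W \<longrightarrow> (\<exists>V\<in>range B. V \<subseteq> W)" using B(4) by simp
  moreover have "compactin X {x}" using x by (simp add: finite_imp_compactin)
  moreover have "countable (range B)" by simp
  ultimately show ?thesis unfolding feathered_def by blast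
qed

lemma omega_omega_base_imp_countable_cs_star_character:
  fixes U :: "(nat \<Rightarrow> nat) \<Rightarrow> 'a set"
  assumes base: "nbhd_base X x (range U)" and mono: "\<And>\<alpha> \<beta>. \<alpha> \<le> \<beta> \<Longrightarrow> U \<beta> \<subseteq> U \<alpha>"
  shows "countable_cs_star_character_at X x"
proof -
  \<comment> \<open>If no \<open>D (\<alpha>|k)\<close> catches infinitely many terms, the witnesses \<open>\<beta> k\<close> agree with \<open>\<alpha>\<close> below
    \<open>k\<close>, so they have a pointwise supremum \<open>\<gamma>\<close>, and \<open>U \<gamma>\<close> misses infinitely many terms.\<close>
  define D where "D a = (\<Inter>{U \<beta> |\<beta>. \<forall>i<length a. \<beta> i = a ! i})" for a :: "nat list"
  have D_sub: "D (map \<alpha> [0..<k]) \<subseteq> U \<alpha>" for \<alpha> k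
    unfolding D_def by (intro Inter_lower) auto
  have x_in: "x \<in> U \<alpha>" and U_sub: "U \<alpha> \<subseteq> topspace X" for \<alpha>
    using base unfolding nbhd_base_def nbhd_def by auto
  have "cs_star_network_at X x (range D)"
    unfolding cs_star_network_at_def
  proof (intro conjI ballI allI impI)
    fix N assume "N \<in> range D"
    then obtain a where "N = D a" by blast
    moreover have "D a \<subseteq> U (\<lambda>i. if i < length a then a ! i else 0)"
      unfolding D_def by (intro Inter_lower) (auto intro!: exI)
    ultimately show "N \<subseteq> topspace X" using U_sub by blast
  next
    fix s :: "nat \<Rightarrow> 'a" and V
    assume *: "range s \<subseteq> topspace X \<and> limitin X s x sequentially \<and> nbhd X x V"
    then obtain \<alpha> where \<alpha>: "U \<alpha> \<subseteq> V" using base unfolding nbhd_base_def by blast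
    have "\<exists>k. infinite {n. s n \<in> D (map \<alpha> [0..<k])}"
    proof (rule ccontr)
      assume "\<not> ?thesis"
      then have fin: "finite {n. s n \<in> D (map \<alpha> [0..<k])}" for k by blast
      have "\<exists>n \<beta>. k \<le> n \<and> (\<forall>i<k. \<beta> i = \<alpha> i) \<and> s n \<notin> U \<beta>" for k
      proof -
        obtain n where n: "k \<le> n" "s n \<notin> D (map \<alpha> [0..<k])"
        proof -
          obtain m where "\<forall>n\<in>{n. s n \<in> D (map \<alpha> [0..<k])}. n < m"
            using fin[of k] finite_nat_set_iff_bounded by blast
          then have "s (max k m) \<notin> D (map \<alpha> [0..<k])" by force
          then show ?thesis using that[of "max k m"] by simp
        qed
        then show ?thesis unfolding D_def by auto
      qed
      then obtain n \<beta> where n\<beta>: "\<And>k. k \<le> n k" "\<And>k i. i < k \<Longrightarrow> \<beta> k i = \<alpha> i" "\<And>k. s (n k) \<notin> U (\<beta> k)"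
        by metis
      \<comment> \<open>For \<open>k > i\<close> the value \<open>\<beta> k i\<close> is
        \<open>\<alpha> i\<close>, so the supremum over all \<open>k\<close> is a maximum over the
        finitely many \<open>k \<le> i\<close> together with \<open>\<alpha> i\<close>.\<close>
      define \<gamma> where "\<gamma> i = Max (insert (\<alpha> i) ((\<lambda>k. \<beta> k i) ` {..i}))" for i
      have "\<beta> k \<le> \<gamma>" for k
      proof (rule le_funI)
        fix i
        have "\<beta> k i \<in> insert (\<alpha> i) ((\<lambda>k. \<beta> k i) ` {..i})"
          using n\<beta>(2)[of i k] by (cases "i < k") auto
        then show "\<beta> k i \<le> \<gamma> i" unfolding \<gamma>_def by (intro Max_ge) auto
      qed
      then have out: "s (n k) \<notin> U \<gamma>" for k using mono n\<beta>(3) by blast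
      have "nbhd X x (U \<gamma>)" using base unfolding nbhd_base_def by blast
      then obtain W where "openin X W" "x \<in> W" "W \<subseteq> U \<gamma>" unfolding nbhd_def by blast
      then have "\<exists>m. \<forall>j\<ge>m. s j \<in> W"
        using * by (simp add: limitin_sequentially)
      then obtain m where "\<forall>j\<ge>m. s j \<in> W" ..
      then show False using out[of m] n\<beta>(1)[of m] \<open>W \<subseteq> U \<gamma>\<close> by blast
    qed
    then obtain k where "infinite {n. s n \<in> D (map \<alpha> [0..<k])}" ..
    moreover have "x \<in> D a" for a unfolding D_def using x_in by auto
    ultimately show "\<exists>N\<in>range D. x \<in> N \<and> N \<subseteq> V \<and> infinite {n. s n \<in> N}"
      using D_sub[of \<alpha> k] \<alpha> by (intro bexI[of _ "D (map \<alpha> [0..<k])"]) auto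
  qed
  moreover have "countable (range D)" by simp
  ultimately show ?thesis unfolding countable_cs_star_character_at_def by blast
qed

section \<open>Neighbourhoods and chains of compact sets\<close>

lemma nbhd_imp_mem: "nbhd X x V \<Longrightarrow> x \<in> V"
  by (auto simp: nbhd_def)

lemma openin_imp_nbhd: "openin X W \<Longrightarrow> x \<in> W \<Longrightarrow> nbhd X x W"
  using openin_subset by (auto simp: nbhd_def)

lemma nbhd_Int: "nbhd X x V \<Longrightarrow> nbhd X x W \<Longrightarrow> nbhd X x (V \<inter> W)"
  unfolding nbhd_def by (metis IntI Int_mono inf.coboundedI1 openin_Int)

lemma nbhd_mono: "nbhd X x V \<Longrightarrow> V \<subseteq> W \<Longrightarrow> W \<subseteq> topspace X \<Longrightarrow> nbhd X x W"
  unfolding nbhd_def by blast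

text \<open>One compact member is covered by \<open>W\<close> and the complements of the members,
  hence by finitely many of these sets; the smallest member involved must then lie in
  \<open>W\<close>. The case \<open>W = {}\<close> says that a chain of nonempty compact sets has
  nonempty intersection.\<close>

lemma compactin_chain_Inter_subset:
  assumes "Hausdorff_space X" "I \<noteq> {}"
    and comp: "\<And>i. i \<in> I \<Longrightarrow> compactin X (A i)"
    and chain: "\<And>i j. \<lbrakk>i \<in> I; j \<in> I\<rbrakk> \<Longrightarrow> A i \<subseteq> A j \<or> A j \<subseteq> A i"
    and W: "openin X W" "(\<Inter>i\<in>I. A i) \<subseteq> W"
  shows "\<exists>i\<in>I. A i \<subseteq> W"
proof -
  obtain i0 where i0: "i0 \<in> I" using assms by blast
  define \<U> where "\<U> = insert W ((\<lambda>i. topspace X - A i) ` I)"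
  have op: "openin X U" if "U \<in> \<U>" for U
    using that W comp assms(1) unfolding \<U>_def by (auto intro!: openin_diff compactin_imp_closedin)
  have "A i0 \<subseteq> \<Union>\<U>"
  proof
    fix a assume a: "a \<in> A i0"
    then have "a \<in> topspace X" using comp[OF i0] compactin_subset_topspace by blast
    moreover have "a \<in> W \<or> (\<exists>i\<in>I. a \<notin> A i)" using W(2) by blast
    ultimately show "a \<in> \<Union>\<U>" unfolding \<U>_def by blast
  qed
  then obtain \<F> where \<F>: "finite \<F>" "\<F> \<subseteq> \<U>" "A i0 \<subseteq> \<Union>\<F>"
    using compactinD[OF comp[OF i0]] op by metis
  obtain J where J: "finite J" "J \<subseteq> I" "\<F> - {W} \<subseteq> (\<lambda>i. topspace X - A i) ` J"
    using finite_subset_image[of "\<F> - {W}" "\<lambda>i. topspace X - A i" I] \<F> unfolding \<U>_def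
    by (metis Diff_subset_conv equalityE finite_Diff insert_is_Un)
  have "\<exists>i\<in>I. \<forall>j\<in>insert i0 J. A i \<subseteq> A j"
  proof -
    have "\<exists>i\<in>I. \<forall>j\<in>K. A i \<subseteq> A j" if "finite K" "K \<noteq> {}" "K \<subseteq> I" for K
      using that
    proof (induction K rule: finite_ne_induct)
      case (singleton x)
      then show ?case by auto
    next
      case (insert x F)
      then obtain i where "i \<in> I" "\<forall>j\<in>F. A i \<subseteq> A j" by auto
      then show ?case using chain[of x i] insert.prems by (metis insert_iff insert_subset subset_refl subset_trans)
    qed
    from this[of "insert i0 J"] show ?thesis using J i0 by simp
  qed
  then obtain i where i: "i \<in> I" "\<And>j. j \<in> insert i0 J \<Longrightarrow> A i \<subseteq> A j" by blast
  have "A i \<subseteq> W"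
  proof
    fix a assume a: "a \<in> A i"
    then have "a \<in> A i0" using i by blast
    then obtain U where "U \<in> \<F>" "a \<in> U" using \<F> by blast
    then show "a \<in> W" using J(3) i(2) a by fastforce
  qed
  then show ?thesis using i by blast
qed

section \<open>Cosets in gyrogroups\<close>

context gyrogroup
begin

definition symmetric_invariant :: "'a set \<Rightarrow> bool"
  where "symmetric_invariant A \<longleftrightarrow> A \<subseteq> G \<and> (\<forall>a\<in>A. neg a \<in> A) \<and>
    (\<forall>x\<in>G. \<forall>y\<in>G. \<forall>a\<in>A. gyr x y a \<in> A)"

text \<open>For \<open>A \<subseteq> G\<close> this is the left translate
  \<open>x \<oplus> A\<close>. The membership form makes it usable as an entourage and lets it
  commute with intersections.\<close>

definition coset :: "'a set \<Rightarrow> 'a \<Rightarrow> 'a set"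
  where "coset A x = {y \<in> G. neg x \<oplus> y \<in> A}"

lemma gyr_closed: "\<lbrakk>x \<in> G; y \<in> G; z \<in> G\<rbrakk> \<Longrightarrow> gyr x y z \<in> G"
  using gyr_bij by (meson bij_betwE)

lemma gyr_inj: "\<lbrakk>x \<in> G; y \<in> G; a \<in> G; b \<in> G; gyr x y a = gyr x y b\<rbrakk> \<Longrightarrow> a = b"
  using gyr_bij by (meson bij_betw_imp_inj_on inj_onD)

text \<open>Translating by \<open>neg x\<close> leaves the injective map
  \<open>gyr (neg x) x\<close>. That this map is the identity is proved only later, in
  \<open>gyr_neg_left\<close>, with the help of cancellation.\<close>

lemma left_cancel:
  assumes "x \<in> G" "y \<in> G" "z \<in> G" "x \<oplus> y = x \<oplus> z"
  shows "y = z"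
proof -
  have "neg x \<oplus> (x \<oplus> w) = gyr (neg x) x w" if "w \<in> G" for w
    using that assms(1) by (simp add: gyr_assoc neg_closed neg_add zero_add gyr_closed)
  then show ?thesis
    using assms gyr_inj[of "neg x" x y z] by (metis neg_closed)
qed

lemma gyr_zero_left:
  assumes "y \<in> G" "z \<in> G" shows "gyr zero y z = z"
proof -
  have "y \<oplus> gyr zero y z = y \<oplus> z"
    using gyr_assoc[of zero y z] assms by (simp add: zero_closed zero_add add_closed)
  then show ?thesis
    using left_cancel assms by (simp add: gyr_closed zero_closed)
qed

lemma neg_neg [simp]: "x \<in> G \<Longrightarrow> neg (neg x) = x"
  using neg_unique[of "neg x" x] by (simp add: add_neg neg_add neg_closed)

text \<open>The loop property replaces \<open>neg x\<close> by
  \<open>neg x \<oplus> x = zero\<close>, and gyrations with first argument \<open>zero\<close> are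
  trivial.\<close>

lemma gyr_neg_left:
  assumes "x \<in> G" "z \<in> G" shows "gyr (neg x) x z = z"
  using gyr_loop[of "neg x" x z] gyr_zero_left[of x z] assms by (simp add: neg_add neg_closed)

lemma neg_add_cancel:
  assumes "x \<in> G" "y \<in> G" shows "neg x \<oplus> (x \<oplus> y) = y"
  using assms by (simp add: gyr_assoc neg_closed neg_add zero_add gyr_neg_left)

lemma add_neg_cancel:
  assumes "x \<in> G" "y \<in> G" shows "x \<oplus> (neg x \<oplus> y) = y"
  using neg_add_cancel[of "neg x" y] assms by (simp add: neg_closed)

lemma neg_zero [simp]: "neg zero = zero"
  using neg_unique[of zero zero] by (simp add: zero_closed zero_add)

lemma right_inverse_eq_neg:
  assumes "x \<in> G" "y \<in> G" "x \<oplus> y = zero" shows "y = neg x"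
  using left_cancel[of x y "neg x"] assms by (simp add: add_neg neg_closed)

text \<open>The gyrogroup form of splitting a difference at an intermediate point. The gyration is
  harmless for gyration-invariant sets, and this is why their cosets compose.\<close>

lemma neg_add_trans:
  assumes "x \<in> G" "y \<in> G" "z \<in> G"
  shows "neg x \<oplus> z = (neg x \<oplus> y) \<oplus> gyr (neg x) y (neg y \<oplus> z)"
  using gyr_assoc[of "neg x" y "neg y \<oplus> z"] assms
  by (simp add: add_neg_cancel neg_closed add_closed)

text \<open>Splitting the difference of \<open>x\<close> with itself at \<open>y\<close> exhibits a
  right inverse. It makes cosets of symmetric invariant sets a symmetric relation.\<close>

lemma neg_neg_add:
  assumes "x \<in> G" "y \<in> G"
  shows "neg (neg x \<oplus> y) = gyr (neg x) y (neg y \<oplus> x)"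
proof -
  have "(neg x \<oplus> y) \<oplus> gyr (neg x) y (neg y \<oplus> x) = zero"
    using neg_add_trans[of x y x] assms by (simp add: neg_add)
  then show ?thesis
    using right_inverse_eq_neg assms by (metis add_closed gyr_closed neg_closed)
qed

lemma neg_gyr:
  assumes "x \<in> G" "y \<in> G" "a \<in> G"
  shows "gyr x y (neg a) = neg (gyr x y a)"
proof (rule right_inverse_eq_neg)
  have z: "gyr x y zero = zero"
  proof -
    have "gyr x y zero \<oplus> gyr x y zero = gyr x y zero \<oplus> zero"
      using gyr_add[of x y zero zero] assms by (simp add: zero_closed zero_add add_zero gyr_closed)
    then show ?thesis
      using left_cancel[of "gyr x y zero" "gyr x y zero" zero] assms gyr_closed zero_closed by simp
  qed
  show "gyr x y a \<oplus> gyr x y (neg a) = zero"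
    using gyr_add[of x y a "neg a"] z assms by (simp add: neg_closed add_neg)
qed (use assms in \<open>auto simp: gyr_closed neg_closed\<close>)

lemma coset_subset: "coset A x \<subseteq> G"
  by (auto simp: coset_def)

lemma coset_mono: "A \<subseteq> B \<Longrightarrow> coset A x \<subseteq> coset B x"
  by (auto simp: coset_def)

lemma coset_refl: "\<lbrakk>zero \<in> A; x \<in> G\<rbrakk> \<Longrightarrow> x \<in> coset A x"
  by (simp add: coset_def neg_add)

lemma coset_zero: "A \<subseteq> G \<Longrightarrow> coset A zero = A"
  by (auto simp: coset_def zero_add)

lemma coset_sym:
  assumes "symmetric_invariant A" "x \<in> G" "y \<in> coset A x"
  shows "x \<in> coset A y"
proof -
  have y: "y \<in> G" "neg x \<oplus> y \<in> A" using assms by (auto simp: coset_def)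
  have "neg y \<oplus> x = neg (gyr (neg y) x (neg x \<oplus> y))"
    using neg_neg_add[of y x] assms y by (metis add_closed neg_closed neg_neg)
  then show ?thesis
    using assms y by (simp add: coset_def symmetric_invariant_def neg_closed)
qed

text \<open>The gyration in \<open>neg_add_trans\<close> acts on the second difference, hence the
  invariance is asked of \<open>B\<close>.\<close>

lemma coset_trans:
  assumes "symmetric_invariant B" "x \<in> G" "y \<in> coset A x" "z \<in> coset B y"
    and "\<And>a b. \<lbrakk>a \<in> A; b \<in> B\<rbrakk> \<Longrightarrow> a \<oplus> b \<in> C"
  shows "z \<in> coset C x"
  using assms neg_add_trans[of x y z] by (auto simp: coset_def symmetric_invariant_def neg_closed)

lemma coset_add_right: "\<lbrakk>A \<subseteq> G; x \<in> G; a \<in> A\<rbrakk> \<Longrightarrow> x \<oplus> a \<in> coset A x"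
  by (auto simp: coset_def add_closed neg_add_cancel)

lemma coset_eq_image: 
  assumes "A \<subseteq> G" "x \<in> G" shows "coset A x = (\<lambda>a. x \<oplus> a) ` A"
proof
  show "coset A x \<subseteq> (\<lambda>a. x \<oplus> a) ` A"
    using assms add_neg_cancel by (force simp: coset_def)
  show "(\<lambda>a. x \<oplus> a) ` A \<subseteq> coset A x"
    using assms coset_add_right by blast
qed

definition invariant_subgyrogroup :: "'a set \<Rightarrow> bool"
  where "invariant_subgyrogroup L \<longleftrightarrow>
    symmetric_invariant L \<and> zero \<in> L \<and> (\<forall>a\<in>L. \<forall>b\<in>L. a \<oplus> b \<in> L)"

lemma coset_eq:
  assumes L: "invariant_subgyrogroup L" and x: "x \<in> G" and y: "y \<in> coset L x"
  shows "coset L y = coset L x"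
proof -
  have s: "symmetric_invariant L" and p: "\<And>a b. \<lbrakk>a \<in> L; b \<in> L\<rbrakk> \<Longrightarrow> a \<oplus> b \<in> L"
    using L by (auto simp: invariant_subgyrogroup_def)
  have "y \<in> G" using y coset_subset by blast
  then show ?thesis
    using coset_trans[OF s _ _ _ p] coset_sym[OF s x y] x y by blast
qed

lemma invariant_subgyrogroup_Inter:
  assumes "I \<noteq> {}" "\<And>i. i \<in> I \<Longrightarrow> invariant_subgyrogroup (A i)"
  shows "invariant_subgyrogroup (\<Inter>i\<in>I. A i)"
  unfolding invariant_subgyrogroup_def symmetric_invariant_def
proof (intro conjI ballI INT_I)
  obtain i where "i \<in> I" using assms(1) by blast
  then show "(\<Inter>i\<in>I. A i) \<subseteq> G"
    using assms(2)[of i] by (auto simp: invariant_subgyrogroup_def symmetric_invariant_def)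
qed (use assms(2) in \<open>auto simp: invariant_subgyrogroup_def symmetric_invariant_def\<close>)

lemma invariant_subgyrogroup_INT_halving:
  fixes U :: "nat \<Rightarrow> 'a set"
  assumes "\<And>n. symmetric_invariant (U n)" "\<And>n. zero \<in> U n"
    and "\<And>n a b. \<lbrakk>a \<in> U (Suc n); b \<in> U (Suc n)\<rbrakk> \<Longrightarrow> a \<oplus> b \<in> U n"
  shows "invariant_subgyrogroup (\<Inter>n. U n)"
  unfolding invariant_subgyrogroup_def symmetric_invariant_def
proof (intro conjI ballI INT_I)
  show "(\<Inter>n. U n) \<subseteq> G" using assms(1)[of 0] by (auto simp: symmetric_invariant_def)
qed (use assms in \<open>auto simp: symmetric_invariant_def\<close>)

end

section \<open>Translations and neighbourhoods in topological gyrogroups\<close>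

context topological_gyrogroup
begin

lemma continuous_map_left_translation:
  "x \<in> topspace X \<Longrightarrow> continuous_map X X (\<lambda>y. x \<oplus> y)"
  using continuous_map_compose[of X "prod_topology X X" "\<lambda>y. (x, y)" X "\<lambda>p. fst p \<oplus> snd p", OF _ continuous_add]
  by (simp add: o_def continuous_map_pairwise)

lemma continuous_map_right_translation:
  "x \<in> topspace X \<Longrightarrow> continuous_map X X (\<lambda>y. y \<oplus> x)"
  using continuous_map_compose[of X "prod_topology X X" "\<lambda>y. (y, x)" X "\<lambda>p. fst p \<oplus> snd p", OF _ continuous_add]
  by (simp add: o_def continuous_map_pairwise)

lemma limitin_add:
  assumes "limitin X f a F" "limitin X g b F"
  shows "limitin X (\<lambda>i. f i \<oplus> g i) (a \<oplus> b) F"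
  using continuous_map_limit[OF continuous_add, of "\<lambda>i. (f i, g i)" "(a, b)" F] assms
  by (simp add: limitin_pairwise o_def)

lemma limitin_neg: "limitin X f a F \<Longrightarrow> limitin X (\<lambda>i. neg (f i)) (neg a) F"
  using continuous_map_limit[OF continuous_neg] by (fastforce simp: o_def)

lemma openin_left_translation:
  assumes "openin X W" "x \<in> topspace X"
  shows "openin X {y \<in> topspace X. x \<oplus> y \<in> W}"
  by (rule openin_continuous_map_preimage[OF continuous_map_left_translation[OF assms(2)] assms(1)])

lemma openin_right_translation:
  assumes "openin X W" "x \<in> topspace X"
  shows "openin X {y \<in> topspace X. y \<oplus> x \<in> W}"
  by (rule openin_continuous_map_preimage[OF continuous_map_right_translation[OF assms(2)] assms(1)])

lemma compactin_coset:
  assumes "compactin X A" "x \<in> topspace X"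
  shows "compactin X (coset A x)"
  using image_compactin[OF assms(1) continuous_map_left_translation[OF assms(2)]]
    coset_eq_image[OF compactin_subset_topspace[OF assms(1)] assms(2)] by simp

lemma nbhd_coset:
  assumes "nbhd X zero U" "x \<in> topspace X"
  shows "nbhd X x (coset U x)"
proof -
  obtain Q where Q: "openin X Q" "zero \<in> Q" "Q \<subseteq> U" using assms by (auto simp: nbhd_def)
  have "openin X {y \<in> topspace X. neg x \<oplus> y \<in> Q}"
    using openin_left_translation Q assms neg_closed by blast
  moreover have "x \<in> {y \<in> topspace X. neg x \<oplus> y \<in> Q}"
    using Q assms by (simp add: neg_add)
  moreover have "{y \<in> topspace X. neg x \<oplus> y \<in> Q} \<subseteq> coset U x"
    using Q by (auto simp: coset_def)
  ultimately show ?thesis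
    using coset_subset unfolding nbhd_def by blast
qed

lemma nbhd_left_translation:
  assumes "openin X W" "x \<in> W"
  shows "nbhd X zero {y \<in> topspace X. x \<oplus> y \<in> W}"
proof (rule openin_imp_nbhd)
  have "x \<in> topspace X" using assms openin_subset by blast
  then show "openin X {y \<in> topspace X. x \<oplus> y \<in> W}" "zero \<in> {y \<in> topspace X. x \<oplus> y \<in> W}"
    using assms openin_left_translation by (auto simp: zero_closed add_zero)
qed

text \<open>Left translations carry a base at the identity to every point. This supplies the
  condition on open sets in \<open>metrizable_space_entourages\<close>.\<close>

lemma openin_iff_coset:
  assumes B: "\<And>n. nbhd X zero (B n)" "\<And>W. nbhd X zero W \<Longrightarrow> \<exists>n. B n \<subseteq> W"
  shows "openin X W \<longleftrightarrow> W \<subseteq> topspace X \<and> (\<forall>x\<in>W. \<exists>n. coset (B n) x \<subseteq> W)"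
proof
  assume W: "openin X W"
  have "\<exists>n. coset (B n) x \<subseteq> W" if x: "x \<in> W" for x
  proof -
    obtain n where n: "B n \<subseteq> {y \<in> topspace X. x \<oplus> y \<in> W}"
      using B(2)[OF nbhd_left_translation[OF W x]] by blast
    have "x \<in> topspace X" using W x openin_subset by blast
    then have "coset (B n) x \<subseteq> W"
      using n add_neg_cancel[of x] by (auto simp: coset_def)
    then show ?thesis ..
  qed
  then show "W \<subseteq> topspace X \<and> (\<forall>x\<in>W. \<exists>n. coset (B n) x \<subseteq> W)"
    using W openin_subset by blast
next
  assume W: "W \<subseteq> topspace X \<and> (\<forall>x\<in>W. \<exists>n. coset (B n) x \<subseteq> W)"
  show "openin X W"
  proof (subst openin_subopen, intro ballI)
    fix x assume "x \<in> W"
    then obtain n where "coset (B n) x \<subseteq> W" "x \<in> topspace X" using W by blast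
    then show "\<exists>T. openin X T \<and> x \<in> T \<and> T \<subseteq> W"
      using nbhd_coset[OF B(1)[of n], of x] unfolding nbhd_def by (meson subset_trans)
  qed
qed

definition invariant_nbhd :: "'a set \<Rightarrow> bool"
  where "invariant_nbhd U \<longleftrightarrow> nbhd X zero U \<and> symmetric_invariant U"

lemma invariant_nbhdD:
  assumes "invariant_nbhd U"
  shows "nbhd X zero U" "symmetric_invariant U" "zero \<in> U" "U \<subseteq> topspace X"
  using assms nbhd_imp_mem by (auto simp: invariant_nbhd_def symmetric_invariant_def)

text \<open>A point \<open>p\<close> of the closure has some \<open>u \<in> N\<close> in its
  translate \<open>coset U p\<close>; by symmetry \<open>p\<close> lies in \<open>coset U u\<close>,
  so it is a sum of two elements of \<open>U\<close>.\<close>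

lemma closure_of_subset_double:
  assumes U: "invariant_nbhd U" and double: "\<And>a b. \<lbrakk>a \<in> U; b \<in> U\<rbrakk> \<Longrightarrow> a \<oplus> b \<in> V" and "N \<subseteq> U"
  shows "X closure_of N \<subseteq> V"
proof
  fix p assume p: "p \<in> X closure_of N"
  then have pX: "p \<in> topspace X" by (simp add: in_closure_of)
  obtain W where "openin X W" "p \<in> W" "W \<subseteq> coset U p"
    using nbhd_coset[OF invariant_nbhdD(1)[OF U] pX] by (auto simp: nbhd_def)
  then obtain u where u: "u \<in> U" "u \<in> coset U p"
    using p assms(3) unfolding in_closure_of by blast
  have "p \<in> coset U u" using coset_sym invariant_nbhdD(2)[OF U] u pX by blast
  moreover have "u \<in> coset U zero" using u invariant_nbhdD(4)[OF U] coset_zero by simp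
  ultimately have "p \<in> coset V zero"
    using coset_trans[of U zero u U p V] invariant_nbhdD(2)[OF U] double zero_closed by blast
  then show "p \<in> V" by (auto simp: coset_def zero_add)
qed

end

section \<open>Invariant neighbourhoods and metrization from a countable base\<close>

context strongly_topological_gyrogroup
begin

text \<open>Continuity of addition at \<open>(zero, zero)\<close> gives a neighbourhood whose sums
  stay in \<open>W\<close>, and the gyration-invariant base provides \<open>V\<close> inside it.
  Keeping the points of \<open>V\<close> whose inverse is in \<open>V\<close> preserves invariance,
  since gyrations commute with \<open>neg\<close>.\<close>

lemma invariant_nbhd_halving:
  assumes W: "nbhd X zero W"
  obtains U where "invariant_nbhd U" "\<And>a b. \<lbrakk>a \<in> U; b \<in> U\<rbrakk> \<Longrightarrow> a \<oplus> b \<in> W" "U \<subseteq> W"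
proof -
  obtain Q where Q: "openin X Q" "zero \<in> Q" "Q \<subseteq> W" using W by (auto simp: nbhd_def)
  define S where "S = {p \<in> topspace (prod_topology X X). fst p \<oplus> snd p \<in> Q}"
  have "openin (prod_topology X X) S"
    unfolding S_def by (rule openin_continuous_map_preimage[OF continuous_add Q(1)])
  moreover have "(zero, zero) \<in> S"
    using Q by (simp add: S_def zero_closed zero_add)
  ultimately obtain A B where AB: "openin X A" "openin X B" "zero \<in> A" "zero \<in> B" "A \<times> B \<subseteq> S"
    unfolding openin_prod_topology_alt by meson
  have AB_nbhd: "nbhd X zero (A \<inter> B)" by (intro openin_imp_nbhd openin_Int IntI AB)
  obtain \<U> where \<U>: "nbhd_base X zero \<U>"
    "\<forall>U\<in>\<U>. \<forall>x\<in>topspace X. \<forall>y\<in>topspace X. gyr x y ` U = U"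
    using gyr_invariant_base by blast
  obtain V where "V \<in> \<U>" "V \<subseteq> A \<inter> B"
    using \<U>(1) AB_nbhd unfolding nbhd_base_def by blast
  then have V: "nbhd X zero V" "V \<subseteq> A \<inter> B"
    "\<And>x y. \<lbrakk>x \<in> topspace X; y \<in> topspace X\<rbrakk> \<Longrightarrow> gyr x y ` V = V"
    using \<U> unfolding nbhd_base_def by auto
  define U where "U = {u \<in> V. neg u \<in> V}"
  have VX: "V \<subseteq> topspace X" using V by (simp add: nbhd_def)
  obtain P where P: "openin X P" "zero \<in> P" "P \<subseteq> V" using V by (auto simp: nbhd_def)
  have "openin X {u \<in> topspace X. neg u \<in> P}"
    by (rule openin_continuous_map_preimage[OF continuous_neg P(1)])
  then have "nbhd X zero (P \<inter> {u \<in> topspace X. neg u \<in> P})"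
    using P by (intro openin_imp_nbhd) (auto simp: zero_closed)
  then have "nbhd X zero U"
    by (rule nbhd_mono) (use P VX in \<open>auto simp: U_def\<close>)
  moreover have "symmetric_invariant U"
    unfolding symmetric_invariant_def
  proof (intro conjI ballI)
    show "U \<subseteq> topspace X" using VX by (auto simp: U_def)
    show "neg a \<in> U" if "a \<in> U" for a
      using that VX by (auto simp: U_def)
    show "gyr x y a \<in> U" if "x \<in> topspace X" "y \<in> topspace X" "a \<in> U" for x y a
    proof -
      have "a \<in> V" "neg a \<in> V" "a \<in> topspace X" using that VX by (auto simp: U_def)
      moreover have "gyr x y b \<in> V" if "b \<in> V" for b
        using V(3)[of x y] that \<open>x \<in> topspace X\<close> \<open>y \<in> topspace X\<close> by blast
      ultimately show ?thesis using neg_gyr[of x y a] that by (simp add: U_def flip: neg_gyr)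
    qed
  qed
  ultimately have "invariant_nbhd U" by (simp add: invariant_nbhd_def)
  moreover have "a \<oplus> b \<in> W" if "a \<in> U" "b \<in> U" for a b
    proof -
    have "(a, b) \<in> S" using that V(2) AB(5) by (auto simp: U_def)
    then show ?thesis using Q by (auto simp: S_def)
  qed
  moreover have "U \<subseteq> W"
  proof
    fix u assume "u \<in> U"
    then have "u \<oplus> zero \<in> W" using calculation invariant_nbhdD(3) by blast
    then show "u \<in> W" using \<open>u \<in> U\<close> VX by (simp add: U_def add_zero subset_iff)
  qed
  ultimately show ?thesis using that by blast
qed

lemma Hausdorff_ex_invariant_nbhd:
  assumes "Hausdorff_space X" "x \<in> topspace X" "x \<noteq> zero"
  obtains U where "invariant_nbhd U" "x \<notin> U"
proof -
  obtain V W where "openin X V" "openin X W" "zero \<in> V" "x \<in> W" "disjnt V W"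
    using assms zero_closed unfolding Hausdorff_space_def by metis
  then obtain U where "invariant_nbhd U" "U \<subseteq> V"
    by (metis invariant_nbhd_halving openin_imp_nbhd)
  then show ?thesis
    using that[of U] \<open>x \<in> W\<close> \<open>disjnt V W\<close> by (auto simp: disjnt_iff)
qed

lemma invariant_nbhd_chain:
  assumes "\<And>n. nbhd X zero (B n)"
  obtains U where "\<And>n. invariant_nbhd (U n)" "\<And>n. U n \<subseteq> B n"
    "\<And>n a b. \<lbrakk>a \<in> U (Suc n); b \<in> U (Suc n)\<rbrakk> \<Longrightarrow> a \<oplus> b \<in> U n" "\<And>m n. m \<le> n \<Longrightarrow> U n \<subseteq> U m"
proof -
  have "\<exists>U. \<forall>n. (invariant_nbhd (U n) \<and> U n \<subseteq> B n) \<and>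
      (U (Suc n) \<subseteq> U n \<and> (\<forall>a\<in>U (Suc n). \<forall>b\<in>U (Suc n). a \<oplus> b \<in> U n))"
  proof (rule dependent_nat_choice)
    show "\<exists>U. invariant_nbhd U \<and> U \<subseteq> B 0"
      by (rule invariant_nbhd_halving[OF assms[of 0]]) blast
  next
    fix U n assume "invariant_nbhd U \<and> U \<subseteq> B n"
    then have "nbhd X zero (U \<inter> B (Suc n))"
      using nbhd_Int[OF invariant_nbhdD(1) assms[of "Suc n"], of U] by blast
    then show "\<exists>V. (invariant_nbhd V \<and> V \<subseteq> B (Suc n)) \<and> (V \<subseteq> U \<and> (\<forall>a\<in>V. \<forall>b\<in>V. a \<oplus> b \<in> U))"
      by (rule invariant_nbhd_halving) blast
  qed
  then obtain U where U: "\<forall>n. (invariant_nbhd (U n) \<and> U n \<subseteq> B n) \<and>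
      (U (Suc n) \<subseteq> U n \<and> (\<forall>a\<in>U (Suc n). \<forall>b\<in>U (Suc n). a \<oplus> b \<in> U n))" by (rule exE)
  show ?thesis
  proof (rule that[of U])
    show "invariant_nbhd (U n)" "U n \<subseteq> B n" for n using U by blast+
    show "a \<oplus> b \<in> U n" if "a \<in> U (Suc n)" "b \<in> U (Suc n)" for a b n
      using U that by blast
    have "U (Suc n) \<subseteq> U n" for n using U by blast
    then show "U n \<subseteq> U m" if "m \<le> n" for m n
      using lift_Suc_antimono_le[of U m n] that by blast
  qed
qed

lemma metrizable_if_countable_base_at_zero:
  assumes haus: "Hausdorff_space X"
    and \<B>: "countable \<B>" "nbhd_base X zero \<B>"
  shows "metrizable_space X"
proof -
  have "nbhd X zero (topspace X)" by (rule openin_imp_nbhd) (auto simp: zero_closed)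
  then have "\<B> \<noteq> {}" using \<B> unfolding nbhd_base_def by blast
  then have B: "nbhd X zero (from_nat_into \<B> n)" for n
    using \<B> from_nat_into unfolding nbhd_base_def by blast
  have B': "\<exists>n. from_nat_into \<B> n \<subseteq> W" if "nbhd X zero W" for W
    using \<B> that from_nat_into_surj unfolding nbhd_base_def by metis
  obtain U where U: "\<And>n. invariant_nbhd (U n)" "\<And>n. U n \<subseteq> from_nat_into \<B> n"
    "\<And>n a b. \<lbrakk>a \<in> U (Suc n); b \<in> U (Suc n)\<rbrakk> \<Longrightarrow> a \<oplus> b \<in> U n" "\<And>m n. m \<le> n \<Longrightarrow> U n \<subseteq> U m"
    using invariant_nbhd_chain[of "from_nat_into \<B>", OF B] by metis
  \<comment> \<open>Every second term is taken because \<open>U\<close> only absorbs sums of two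
    elements, while the entourages must absorb three consecutive steps: two halvings do
    this.\<close>
  define V where "V n = U (2 * n)" for n
  have V: "invariant_nbhd (V n)" for n using U(1) by (simp add: V_def)
  note V_sym = invariant_nbhdD(2)[OF V]
  have V_base: "\<exists>n. V n \<subseteq> W" if W: "nbhd X zero W" for W
  proof -
    obtain n where "from_nat_into \<B> n \<subseteq> W" using B'[OF W] by blast
    then have "V n \<subseteq> W" using U(2)[of n] U(4)[of n "2 * n"] by (auto simp: V_def)
    then show ?thesis ..
  qed
  show ?thesis
  proof (rule metrizable_space_entourages[where E = "\<lambda>n. coset (V n)"])
    show "x \<in> coset (V n) x" if "x \<in> topspace X" for n x
      using that coset_refl invariant_nbhdD(3)[OF V] by blast
    show "x \<in> coset (V n) y" if "x \<in> topspace X" "y \<in> topspace X" "y \<in> coset (V n) x" for n x y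
      using that coset_sym V_sym by blast
    show "w \<in> coset (V n) x"
      if "x \<in> topspace X" "y \<in> topspace X" "z \<in> topspace X" "w \<in> topspace X"
        "y \<in> coset (V (Suc n)) x" "z \<in> coset (V (Suc n)) y" "w \<in> coset (V (Suc n)) z" for n x y z w
    proof -
      define U1 U2 where "U1 = U (Suc (2 * n))" and "U2 = V (Suc n)"
      have U2: "U2 = U (Suc (Suc (2 * n)))" by (simp add: U2_def V_def)
      have s: "symmetric_invariant U2" "U2 \<subseteq> U1" "\<And>a b. \<lbrakk>a \<in> U2; b \<in> U2\<rbrakk> \<Longrightarrow> a \<oplus> b \<in> U1"
        using invariant_nbhdD(2)[OF U(1)] U(3) U(4)[of "Suc (2 * n)" "Suc (Suc (2 * n))"]
        by (auto simp: U2 U1_def)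
      have "z \<in> coset U1 x"
        by (rule coset_trans[of U2 x y U2]) (use s that in \<open>auto simp: U2_def\<close>)
      moreover have "w \<in> coset U1 z"
        using that coset_mono[OF s(2)] by (auto simp: U2_def)
      moreover have "symmetric_invariant U1" "\<And>a b. \<lbrakk>a \<in> U1; b \<in> U1\<rbrakk> \<Longrightarrow> a \<oplus> b \<in> V n"
        using invariant_nbhdD(2)[OF U(1)] U(3) by (auto simp: U1_def V_def)
      ultimately show ?thesis
        using coset_trans[of U1 x z U1 w "V n"] that by blast
    qed
    show "x = y" if xy: "x \<in> topspace X" "y \<in> topspace X" and all: "\<And>n. y \<in> coset (V n) x" for x y
    proof (rule ccontr)
      assume "x \<noteq> y"
      have "neg x \<oplus> y \<noteq> zero"
        using \<open>x \<noteq> y\<close> xy right_inverse_eq_neg[of "neg x" y] by (auto simp: neg_closed)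
      moreover have "neg x \<oplus> y \<in> topspace X" using xy by (simp add: neg_closed add_closed)
      ultimately obtain W where "invariant_nbhd W" "neg x \<oplus> y \<notin> W"
        using Hausdorff_ex_invariant_nbhd[OF haus] by blast
      then show False
        using V_base[OF invariant_nbhdD(1)] all unfolding coset_def by blast
    qed
    show "openin X W \<longleftrightarrow> W \<subseteq> topspace X \<and> (\<forall>x\<in>W. \<exists>n. coset (V n) x \<inter> topspace X \<subseteq> W)" for W
    proof -
      have "coset (V n) x \<inter> topspace X = coset (V n) x" for n x
        using coset_subset by blast
      moreover have "openin X W \<longleftrightarrow> W \<subseteq> topspace X \<and> (\<forall>x\<in>W. \<exists>n. coset (V n) x \<subseteq> W)"
        by (rule openin_iff_coset) (fact invariant_nbhdD(1)[OF V] V_base)+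
      ultimately show ?thesis by simp
    qed
  qed
qed

section \<open>Sequences converging through dense open sets\<close>

text \<open>The common interface of the two cases: both Frechet-Urysohn and feathered spaces provide
  it, and with it a countable network at the identity yields a countable base.\<close>

definition meets_dense_open_sequences :: bool
  where "meets_dense_open_sequences \<longleftrightarrow>
    (\<forall>D :: nat \<Rightarrow> 'a set. (\<forall>n. openin X (D n)) \<and> (\<forall>n. X closure_of D n = topspace X) \<and> decseq D \<longrightarrow>
      (\<exists>x. (\<forall>n. x n \<in> D n) \<and> limitin X x zero sequentially))"

lemma ex_countable_base_at_zero:
  assumes meets: "meets_dense_open_sequences" and cs: "countable_cs_star_character_at X zero"
  shows "\<exists>\<B>. countable \<B> \<and> nbhd_base X zero \<B>"
proof -
  obtain \<N> where \<N>: "countable \<N>" "cs_star_network_at X zero \<N>"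
    using cs unfolding countable_cs_star_character_at_def by blast
  have \<N>_sub: "N \<subseteq> topspace X" if "N \<in> \<N>" for N
    using \<N>(2) that unfolding cs_star_network_at_def by blast
  have network: "\<exists>N\<in>\<N>. zero \<in> N \<and> N \<subseteq> V \<and> infinite {n. s n \<in> N}"
    if "range s \<subseteq> topspace X" "limitin X s zero sequentially" "nbhd X zero V" for s :: "nat \<Rightarrow> 'a" and V
    using \<N>(2) that unfolding cs_star_network_at_def by blast
  \<comment> \<open>The analogue of the difference set in Steinhaus-type theorems: if
    \<open>p\<close> is interior to the closure of \<open>N\<close>, moving that interior back by
    \<open>neg p\<close> gives a neighbourhood of the identity inside \<open>Dif N\<close>.\<close>
  define Dif where "Dif N = (\<lambda>(a, b). neg a \<oplus> b) ` ((X closure_of N) \<times> (X closure_of N))" for N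
  define \<M> where "\<M> = {N \<in> \<N>. X interior_of (X closure_of N) \<noteq> {}}"
  have "nbhd_base X zero (Dif ` \<M>)"
    unfolding nbhd_base_def
  proof (intro conjI ballI allI impI)
    fix V assume "V \<in> Dif ` \<M>"
    then obtain N where N: "V = Dif N" "X interior_of (X closure_of N) \<noteq> {}"
      by (auto simp: \<M>_def)
    then obtain p where p: "p \<in> X interior_of (X closure_of N)" by blast
    have cl: "p \<in> X closure_of N" using p interior_of_subset by fastforce
    then have pX: "p \<in> topspace X" by (simp add: in_closure_of)
    show "nbhd X zero V"
    proof (rule nbhd_mono)
      show "nbhd X zero {y \<in> topspace X. p \<oplus> y \<in> X interior_of (X closure_of N)}"
        by (rule nbhd_left_translation) (use p in auto)
      show "{y \<in> topspace X. p \<oplus> y \<in> X interior_of (X closure_of N)} \<subseteq> V"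
      proof
        fix y assume y: "y \<in> {y \<in> topspace X. p \<oplus> y \<in> X interior_of (X closure_of N)}"
        then have "(p, p \<oplus> y) \<in> (X closure_of N) \<times> (X closure_of N)"
          using cl interior_of_subset by fastforce
        then have "neg p \<oplus> (p \<oplus> y) \<in> V" unfolding N Dif_def by force
        then show "y \<in> V" using neg_add_cancel pX y by simp
      qed
      show "V \<subseteq> topspace X"
        using closure_of_subset_topspace[of X N] by (auto simp: N Dif_def add_closed neg_closed subset_iff)
    qed
  next
    fix W assume W: "nbhd X zero W"
    \<comment> \<open>Two halvings are needed: from \<open>U'\<close> to \<open>U\<close> to pass to
      the closure of \<open>N\<close>, and from \<open>U\<close> to \<open>W\<close> to form
      differences.\<close>
    obtain U where U: "invariant_nbhd U" and U_W: "\<And>a b. \<lbrakk>a \<in> U; b \<in> U\<rbrakk> \<Longrightarrow> a \<oplus> b \<in> W"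
      using invariant_nbhd_halving[OF W] by metis
    obtain U' where U': "invariant_nbhd U'" and U'_U: "\<And>a b. \<lbrakk>a \<in> U'; b \<in> U'\<rbrakk> \<Longrightarrow> a \<oplus> b \<in> U"
      using invariant_nbhd_halving[OF invariant_nbhdD(1)[OF U]] by metis
    define \<S> where "\<S> = {N \<in> \<N>. N \<subseteq> U'}"
    have "\<exists>N\<in>\<S>. X interior_of (X closure_of N) \<noteq> {}"
    proof (rule ccontr)
      assume "\<not> ?thesis"
      then have empty: "X interior_of (X closure_of N) = {}" if "N \<in> \<S>" for N using that by blast
      \<comment> \<open>The constant sequence at the identity provides a member, so that
        \<open>from_nat_into\<close> really enumerates \<open>\<S>\<close>.\<close>
      have "\<S> \<noteq> {}"
        using network[of "\<lambda>_. zero" U'] invariant_nbhdD(1)[OF U'] zero_closed by (auto simp: \<S>_def)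
      moreover have "countable \<S>" using \<N>(1) by (simp add: \<S>_def)
      ultimately have from_in: "from_nat_into \<S> n \<in> \<S>" and from_surj: "N \<in> \<S> \<Longrightarrow> \<exists>n. from_nat_into \<S> n = N" for n N
        by (auto simp: from_nat_into intro: from_nat_into_surj)
      define F where "F n = X closure_of (from_nat_into \<S> n)" for n
      have F_cl: "closedin X (F n)" for n by (simp add: F_def)
      have F_int: "W \<subseteq> F n \<Longrightarrow> openin X W \<Longrightarrow> W = {}" for n W
        using empty[OF from_in[of n]] interior_of_maximal[of W "F n" X] by (simp add: F_def)
      \<comment> \<open>Each \<open>F i\<close> is closed with empty interior, so removing finitely
        many of them leaves a dense open set.\<close>
      define D where "D n = topspace X - (\<Union>i\<le>n. F i)" for n
      have D_open: "openin X (D n)" for n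
        unfolding D_def using F_cl by (intro openin_diff closedin_Union) auto
      have D_meets: "O' \<inter> D n \<noteq> {}" if O': "openin X O'" "O' \<noteq> {}" for O' n
      proof (induction n)
        case 0
        then show ?case
          using F_int[OF _ O'(1), of 0] O' openin_subset[OF O'(1)] by (auto simp: D_def)
      next
        case (Suc n)
        have "\<not> O' \<inter> D n \<subseteq> F (Suc n)" using F_int[of "O' \<inter> D n" "Suc n"] D_open O' Suc by blast
        then show ?case by (auto simp: D_def atMost_Suc)
      qed
      have "X closure_of D n = topspace X" for n
        unfolding dense_intersects_open using D_meets by (metis Int_commute)
      moreover have "decseq D"
        by (rule decseq_SucI) (auto simp: D_def)
      ultimately obtain x where x: "\<And>n. x n \<in> D n" "limitin X x zero sequentially"
        using meets D_open unfolding meets_dense_open_sequences_def by blast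
      have "range x \<subseteq> topspace X" using x(1) by (auto simp: D_def)
      then obtain N where N: "N \<in> \<N>" "N \<subseteq> U'" "infinite {n. x n \<in> N}"
        using network[OF _ x(2) invariant_nbhdD(1)[OF U']] by blast
      then obtain j where j: "from_nat_into \<S> j = N" using from_surj[of N] by (auto simp: \<S>_def)
      have "N \<subseteq> F j" using j \<N>_sub[OF N(1)] by (simp add: F_def closure_of_subset)
      \<comment> \<open>From index \<open>j\<close> on, the sequence avoids \<open>F j\<close> and
        thus \<open>N\<close>, so \<open>N\<close> catches only finitely many terms.\<close>
      then have "{n. x n \<in> N} \<subseteq> {..<j}"
      proof (intro subsetI)
        fix n assume "n \<in> {n. x n \<in> N}"
        then have "x n \<in> F j" using \<open>N \<subseteq> F j\<close> by blast
        then show "n \<in> {..<j}" using x(1)[of n] by (force simp: D_def)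
      qed
      then show False using N(3) finite_subset by blast
    qed
    then obtain N where N: "N \<in> \<N>" "N \<subseteq> U'" "X interior_of (X closure_of N) \<noteq> {}"
      by (auto simp: \<S>_def)
    have "X closure_of N \<subseteq> U"
      by (rule closure_of_subset_double[OF U' U'_U N(2)])
    then have "Dif N \<subseteq> W"
      using invariant_nbhdD(2)[OF U] by (auto simp: Dif_def symmetric_invariant_def intro!: U_W)
    then show "\<exists>V\<in>Dif ` \<M>. V \<subseteq> W" using N by (auto simp: \<M>_def)
  qed
  moreover have "countable (Dif ` \<M>)" using \<N>(1) by (simp add: \<M>_def)
  ultimately show ?thesis by blast
qed

section \<open>Frechet-Urysohn gyrogroups\<close>

text \<open>
  Nyikos' argument: spread translates of the dense sets along a sequence \<open>z n\<close> converging to the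
  identity; a sequence in the union that converges to the identity must pass through infinitely
  many of the translates, and translating back gives the required points.
\<close>

lemma frechet_urysohn_imp_meets_dense_open_sequences:
  assumes haus: "Hausdorff_space X" and fu: "frechet_urysohn X"
  shows meets_dense_open_sequences
  unfolding meets_dense_open_sequences_def
proof (intro allI impI)
  fix D :: "nat \<Rightarrow> 'a set"
  assume *: "(\<forall>n. openin X (D n)) \<and> (\<forall>n. X closure_of D n = topspace X) \<and> decseq D"
  have D_meets: "D n \<inter> W \<noteq> {}" if "openin X W" "W \<noteq> {}" for n W
    using * that unfolding dense_intersects_open by blast
  have fu': "\<exists>s :: nat \<Rightarrow> 'a. range s \<subseteq> A \<and> limitin X s zero sequentially"
    if "A \<subseteq> topspace X" "zero \<in> X closure_of A" for A
    using fu that unfolding frechet_urysohn_def by blast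
  show "\<exists>x. (\<forall>n. x n \<in> D n) \<and> limitin X x zero sequentially"
  \<comment> \<open>An isolated identity belongs to every dense set, so the constant sequence works;
    otherwise there is a sequence of points other than the identity converging to it.\<close>
  proof (cases "openin X {zero}")
    case True
    then have "zero \<in> D n" for n using D_meets[of "{zero}" n] by auto
    then show ?thesis by (intro exI[of _ "\<lambda>_. zero"]) (simp add: zero_closed)
  next
    case False
    have "zero \<in> X closure_of (topspace X - {zero})"
      unfolding in_closure_of
    proof (intro conjI allI impI)
      fix T assume T: "zero \<in> T \<and> openin X T"
      then have "T \<noteq> {zero}" using False by auto
      then show "\<exists>y. y \<in> topspace X - {zero} \<and> y \<in> T" using T openin_subset by fastforce
    qed (rule zero_closed)
    then obtain z where z: "range z \<subseteq> topspace X - {zero}" "limitin X z zero sequentially"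
      using fu'[of "topspace X - {zero}"] by blast
    \<comment> \<open>Separating \<open>z n\<close> from the identity keeps a sequence that tends to
      the identity from staying in one piece: it is eventually in \<open>Q k\<close> and so leaves
      \<open>P k\<close>.\<close>
    have "\<exists>O' W. openin X O' \<and> openin X W \<and> z n \<in> O' \<and> zero \<in> W \<and> disjnt O' W" for n
    proof -
      have "z n \<in> topspace X" "z n \<noteq> zero" using z(1) by auto
      then show ?thesis using haus zero_closed unfolding Hausdorff_space_def by simp
    qed
    then obtain P Q where PQ: "\<And>n. openin X (P n)" "\<And>n. openin X (Q n)" "\<And>n. z n \<in> P n"
      "\<And>n. zero \<in> Q n" "\<And>n. disjnt (P n) (Q n)"
      by metis
    have zX: "z n \<in> topspace X" for n using z(1) by auto
    define B where "B = (\<Union>n. {b \<in> P n. neg (z n) \<oplus> b \<in> D n})"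
    have P_sub: "P n \<subseteq> topspace X" for n using PQ(1) openin_subset by blast
    have "zero \<in> X closure_of B"
      unfolding in_closure_of
    proof (intro conjI allI impI)
      fix T assume T: "zero \<in> T \<and> openin X T"
      then have "\<forall>\<^sub>F n in sequentially. z n \<in> T" using z(2) unfolding limitin_def by blast
      then obtain n where n: "z n \<in> T" using eventually_sequentially by auto
      have "openin X {y \<in> topspace X. z n \<oplus> y \<in> T \<inter> P n}"
        using T PQ(1) zX by (intro openin_left_translation) auto
      moreover have "zero \<in> {y \<in> topspace X. z n \<oplus> y \<in> T \<inter> P n}"
        using n PQ(3) zX by (simp add: zero_closed add_zero)
      ultimately obtain y where y: "y \<in> D n" "y \<in> topspace X" "z n \<oplus> y \<in> T \<inter> P n"
        using D_meets[of "{y \<in> topspace X. z n \<oplus> y \<in> T \<inter> P n}" n] by blast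
      then have "z n \<oplus> y \<in> B" unfolding B_def using neg_add_cancel[OF zX y(2)] by auto
      then show "\<exists>y. y \<in> B \<and> y \<in> T" using y by blast
    qed (rule zero_closed)
    moreover have "B \<subseteq> topspace X" using P_sub by (auto simp: B_def)
    ultimately obtain b where b: "range b \<subseteq> B" "limitin X b zero sequentially"
      using fu' by blast
    have "\<exists>n. b i \<in> P n \<and> neg (z n) \<oplus> b i \<in> D n" for i
      using b(1) unfolding B_def by blast
    then obtain m where m: "\<And>i. b i \<in> P (m i)" "\<And>i. neg (z (m i)) \<oplus> b i \<in> D (m i)"
      by metis
    have ev_ne: "\<forall>\<^sub>F i in sequentially. m i \<noteq> k" for k
    proof -
      have "\<forall>\<^sub>F i in sequentially. b i \<in> Q k" using b(2) PQ(2,4) unfolding limitin_def by blast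
      then show ?thesis
        by (rule eventually_mono) (use m(1) PQ(5) in \<open>auto simp: disjnt_iff\<close>)
    qed
    have ev_ge: "\<forall>\<^sub>F i in sequentially. k \<le> m i" for k
    proof (induction k)
      case (Suc k)
      then show ?case using ev_ne[of k] by eventually_elim auto
    qed simp
    then have m_lim: "filterlim m sequentially sequentially"
      by (simp add: filterlim_at_top)
    \<comment> \<open>The reindexing makes the \<open>k\<close>-th term come from a piece with index
      at least \<open>k\<close>; as \<open>D\<close> decreases, the translated point then lies in
      \<open>D k\<close>.\<close>
    have "\<exists>i\<ge>k. k \<le> m i" for k
    proof -
      obtain N where "\<forall>i\<ge>N. k \<le> m i" using ev_ge[of k] unfolding eventually_sequentially by blast
      then show ?thesis by (intro exI[of _ "max k N"]) auto
    qed
    then obtain r where r: "\<And>k. k \<le> r k" "\<And>k. k \<le> m (r k)" by metis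
    have r_lim: "filterlim r sequentially sequentially"
      unfolding filterlim_at_top using r(1) by (meson eventually_sequentially order_trans)
    have zr: "limitin X (\<lambda>k. z (m (r k))) zero sequentially"
      using z(2) filterlim_compose[OF m_lim r_lim] unfolding limitin_def filterlim_iff by auto
    have br: "limitin X (\<lambda>k. b (r k)) zero sequentially"
      using b(2) r_lim unfolding limitin_def filterlim_iff by auto
    have "limitin X (\<lambda>k. neg (z (m (r k))) \<oplus> b (r k)) zero sequentially"
      using limitin_add[OF limitin_neg[OF zr] br] by (simp add: zero_closed zero_add)
    moreover have "neg (z (m (r k))) \<oplus> b (r k) \<in> D k" for k
      using m(2)[of "r k"] r(2)[of k] * decseqD by blast
    ultimately show ?thesis by (intro exI[of _ "\<lambda>k. neg (z (m (r k))) \<oplus> b (r k)"]) blast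
  qed
qed

section \<open>Convergent sequences of cosets and their lifting\<close>

text \<open>
  \<open>T 0\<close> is a compact subgyrogroup and the sets \<open>T n\<close> are cosets of it converging to it, i.e. a
  convergent sequence in the quotient by \<open>T 0\<close>.  Putting the subgyrogroup at index 0 makes
  refinement of such a pair the pointwise order on \<^typ>\<open>nat \<Rightarrow> 'a set\<close>.
\<close>

definition coset_sequence :: "(nat \<Rightarrow> 'a set) \<Rightarrow> bool"
  where "coset_sequence T \<longleftrightarrow> invariant_subgyrogroup (T 0) \<and> compactin X (T 0) \<and>
    (\<forall>n. \<exists>c\<in>topspace X. T n = coset (T 0) c) \<and>
    (\<forall>W. openin X W \<and> T 0 \<subseteq> W \<longrightarrow> (\<forall>\<^sub>F n in sequentially. T n \<subseteq> W))"

lemma coset_sequence_eq_coset: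
  assumes "coset_sequence T" "c \<in> T n"
  shows "T n = coset (T 0) c"
  using assms coset_eq unfolding coset_sequence_def by metis

lemma coset_sequence_nonempty:
  assumes "coset_sequence T"
  obtains c where "c \<in> T n" "c \<in> topspace X"
  using assms coset_refl unfolding coset_sequence_def invariant_subgyrogroup_def by metis

lemma coset_sequence_compactin:
  assumes "coset_sequence T" shows "compactin X (T n)"
  using assms compactin_coset unfolding coset_sequence_def by metis

text \<open>Provides the bounds of chains for Zorn's lemma. Compactness keeps each intersection
  nonempty, and a common point represents the coset in all members at once; convergence holds
  because one member \<open>T 0\<close> already fits into any open set around the
  intersection.\<close>

lemma coset_sequence_INT:
  assumes haus: "Hausdorff_space X" and "C \<noteq> {}" and C: "\<And>T. T \<in> C \<Longrightarrow> coset_sequence T"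
    and chain: "\<And>S T. \<lbrakk>S \<in> C; T \<in> C\<rbrakk> \<Longrightarrow> S \<le> T \<or> T \<le> S"
  shows "coset_sequence (\<lambda>n. \<Inter>T\<in>C. T n)"
  unfolding coset_sequence_def
proof (intro conjI allI impI)
  have chain_n: "S n \<subseteq> T n \<or> T n \<subseteq> S n" if "S \<in> C" "T \<in> C" for S T n
    using chain[OF that] by (auto simp: le_fun_def)
  have comp: "compactin X (T n)" if "T \<in> C" for T n
    using C[OF that] by (rule coset_sequence_compactin)
  show "invariant_subgyrogroup (\<Inter>T\<in>C. T 0)"
    by (rule invariant_subgyrogroup_Inter[OF \<open>C \<noteq> {}\<close>]) (use C coset_sequence_def in blast)
  obtain T0 where T0: "T0 \<in> C" using \<open>C \<noteq> {}\<close> by blast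
  show "compactin X (\<Inter>T\<in>C. T 0)"
  proof (rule closed_compactin[OF comp[OF T0]])
    show "(\<Inter>T\<in>C. T 0) \<subseteq> T0 0" using T0 by blast
    show "closedin X (\<Inter>T\<in>C. T 0)"
      by (rule closedin_Inter) (use \<open>C \<noteq> {}\<close> comp compactin_imp_closedin[OF haus] in auto)
  qed
  show "\<exists>c\<in>topspace X. (\<Inter>T\<in>C. T n) = coset (\<Inter>T\<in>C. T 0) c" for n
  proof -
    have "(\<Inter>T\<in>C. T n) \<noteq> {}"
    proof
      assume "(\<Inter>T\<in>C. T n) = {}"
      then have "\<exists>T\<in>C. T n \<subseteq> {}"
        by (intro compactin_chain_Inter_subset[OF haus \<open>C \<noteq> {}\<close>] comp chain_n) auto
      then obtain T where "T \<in> C" "T n \<subseteq> {}" ..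
      then show False using coset_sequence_nonempty[OF C, of T n] by blast
    qed
    then obtain c where c: "\<And>T. T \<in> C \<Longrightarrow> c \<in> T n" by blast
    have eq: "T n = coset (T 0) c" if "T \<in> C" for T
      using coset_sequence_eq_coset[OF C[OF that] c[OF that]] .
    have "(\<Inter>T\<in>C. T n) = (\<Inter>T\<in>C. coset (T 0) c)" using eq by auto
    also have "\<dots> = coset (\<Inter>T\<in>C. T 0) c" using T0 by (auto simp: coset_def)
    finally show ?thesis
      using c[OF T0] compactin_subset_topspace[OF comp[OF T0]] by blast
  qed
  show "\<forall>\<^sub>F n in sequentially. (\<Inter>T\<in>C. T n) \<subseteq> W" if W: "openin X W \<and> (\<Inter>T\<in>C. T 0) \<subseteq> W" for W
  proof -
    have "\<exists>T\<in>C. T 0 \<subseteq> W"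
      by (intro compactin_chain_Inter_subset[OF haus \<open>C \<noteq> {}\<close>] comp chain_n) (use W in auto)
    then obtain T where T: "T \<in> C" "T 0 \<subseteq> W" ..
    then have "\<forall>\<^sub>F n in sequentially. T n \<subseteq> W"
      using C[OF T(1)] W unfolding coset_sequence_def by blast
    then show ?thesis by (rule eventually_mono) (use T in blast)
  qed
qed

text \<open>\<open>T 0\<close> is cut down by the intersection \<open>M\<close> of a halving
  sequence that avoids \<open>l\<close>. The work lies in choosing, inside each \<open>T n\<close>,
  a coset of the smaller subgyrogroup so that the new cosets converge to it.\<close>

lemma coset_sequence_refine:
  assumes haus: "Hausdorff_space X" and T: "coset_sequence T" and l: "l \<in> T 0" "l \<noteq> zero"
  obtains S where "coset_sequence S" "S \<le> T" "l \<notin> S 0"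
proof -
  have L: "invariant_subgyrogroup (T 0)" "compactin X (T 0)"
    and T_conv: "\<And>W. openin X W \<Longrightarrow> T 0 \<subseteq> W \<Longrightarrow> \<forall>\<^sub>F n in sequentially. T n \<subseteq> W"
    using T unfolding coset_sequence_def by auto
  have L_sub: "T 0 \<subseteq> topspace X" using L(2) compactin_subset_topspace by blast
  have L_sym: "symmetric_invariant (T 0)" and L_zero: "zero \<in> T 0"
    using L(1) unfolding invariant_subgyrogroup_def by auto
  have L_neg: "neg a \<in> T 0" if "a \<in> T 0" for a
    using L_sym that unfolding symmetric_invariant_def by auto
  have "l \<in> topspace X" using l L_sub by blast
  then obtain U where U: "invariant_nbhd U" "l \<notin> U" using Hausdorff_ex_invariant_nbhd[OF haus] l by metis
  obtain V where V: "\<And>n. invariant_nbhd (V n)" "\<And>n :: nat. V n \<subseteq> U"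
    "\<And>n a b. \<lbrakk>a \<in> V (Suc n); b \<in> V (Suc n)\<rbrakk> \<Longrightarrow> a \<oplus> b \<in> V n" "\<And>m n. m \<le> n \<Longrightarrow> V n \<subseteq> V m"
    using invariant_nbhd_chain[of "\<lambda>_. U"] invariant_nbhdD(1)[OF U(1)] by metis
  note V_sym = invariant_nbhdD(2)[OF V(1)]
  define M where "M = (\<Inter>n. V n)"
  have M: "invariant_subgyrogroup M"
    unfolding M_def using V_sym invariant_nbhdD(3)[OF V(1)] V(3) by (rule invariant_subgyrogroup_INT_halving)
  \<comment> \<open>The closures interlace with the \<open>V n\<close>, so that \<open>M\<close> is
    also an intersection of closed sets.\<close>
  have cl_V: "X closure_of V (Suc n) \<subseteq> V n" for n
    by (rule closure_of_subset_double[OF V(1) V(3)]) auto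
  have V_cl: "V n \<subseteq> X closure_of V n" for n
    by (rule closure_of_subset[OF invariant_nbhdD(4)[OF V(1)]])
  have M_cl: "M = (\<Inter>n. X closure_of V n)" using cl_V V_cl unfolding M_def by blast
  have M_closed: "closedin X M" unfolding M_cl by (rule closedin_Inter) auto
  \<comment> \<open>The quotient map by \<open>T 0\<close> is open: \<open>W\<close> below is the saturation of \<open>Q\<close>.\<close>
  have T_meets: "\<forall>\<^sub>F n in sequentially. T n \<inter> V k \<noteq> {}" for k
  proof -
    obtain Q where Q: "openin X Q" "zero \<in> Q" "Q \<subseteq> V k"
      using invariant_nbhdD(1)[OF V(1)] unfolding nbhd_def by blast
    define W where "W = (\<Union>a\<in>T 0. {y \<in> topspace X. y \<oplus> a \<in> Q})"
    have "openin X W"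
      unfolding W_def using Q(1) L_sub by (intro openin_Union) (auto intro!: openin_right_translation)
    moreover have "T 0 \<subseteq> W"
    proof
      fix a assume a: "a \<in> T 0"
      then have "a \<in> topspace X" "a \<oplus> neg a \<in> Q" using L_sub Q(2) by (auto simp: add_neg)
      then show "a \<in> W" using L_neg[OF a] unfolding W_def by blast
    qed
    ultimately have "\<forall>\<^sub>F n in sequentially. T n \<subseteq> W" by (rule T_conv)
    then show ?thesis
    proof (rule eventually_mono)
      fix n assume n: "T n \<subseteq> W"
      obtain c where c: "c \<in> T n" "c \<in> topspace X" using coset_sequence_nonempty[OF T] by metis
      then obtain a where a: "a \<in> T 0" "c \<oplus> a \<in> Q" using n unfolding W_def by blast
      then have "c \<oplus> a \<in> T n"
        using coset_add_right[OF L_sub c(2)] coset_sequence_eq_coset[OF T c(1)] by blast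
      then show "T n \<inter> V k \<noteq> {}" using a Q by blast
    qed
  qed
  \<comment> \<open>A representative is taken as deep in the decreasing sets \<open>V k\<close> as
    \<open>T n\<close> reaches; the cutoff \<open>k \<le> n\<close> makes a deepest one exist. By
    \<open>T_meets\<close>, \<open>z n\<close> is then eventually in each
    \<open>V k\<close>.\<close>
  have "\<exists>z\<in>T n. \<forall>k\<le>n. T n \<inter> V k \<noteq> {} \<longrightarrow> z \<in> V k" for n
  proof -
    define K where "K = {k. k \<le> n \<and> T n \<inter> V k \<noteq> {}}"
    have "finite K" by (simp add: K_def)
    show ?thesis
    proof (cases "K = {}")
      case True
      obtain c where "c \<in> T n" by (rule coset_sequence_nonempty[OF T])
      then show ?thesis using True unfolding K_def by (intro bexI[of _ c]) auto
    next
      case False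
      then have "Max K \<in> K" using \<open>finite K\<close> by simp
      then obtain z where z: "z \<in> T n" "z \<in> V (Max K)" unfolding K_def by blast
      have "z \<in> V k" if "k \<in> K" for k
        using z(2) V(4)[of k "Max K"] Max_ge[OF \<open>finite K\<close> that] by blast
      then show ?thesis using z(1) unfolding K_def by blast
    qed
  qed
  then obtain z where z: "\<And>n. z n \<in> T n" "\<And>n k. \<lbrakk>k \<le> n; T n \<inter> V k \<noteq> {}\<rbrakk> \<Longrightarrow> z n \<in> V k"
    by metis
  have T_sub: "T n \<subseteq> topspace X" for n
    using coset_sequence_compactin[OF T] compactin_subset_topspace by blast
  define L' where "L' = T 0 \<inter> M"
  define S where "S n = (if n = 0 then L' else coset L' (z n))" for n
  have L': "invariant_subgyrogroup L'"
    using L(1) M unfolding L'_def invariant_subgyrogroup_def symmetric_invariant_def by auto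
  have S_sub: "S n \<subseteq> T n" for n
  proof (cases "n = 0")
    case False
    have "coset L' (z n) \<subseteq> coset (T 0) (z n)" by (rule coset_mono) (simp add: L'_def)
    also have "\<dots> = T n" by (rule coset_sequence_eq_coset[OF T z(1), symmetric])
    finally show ?thesis using False by (simp add: S_def)
  qed (simp add: S_def L'_def)
  have "coset_sequence S"
    unfolding coset_sequence_def
  proof (intro conjI allI impI)
    show "invariant_subgyrogroup (S 0)" using L' by (simp add: S_def)
    show "compactin X (S 0)"
      using closed_Int_compactin[OF M_closed L(2)] by (simp add: S_def L'_def Int_commute)
    show "\<exists>c\<in>topspace X. S n = coset (S 0) c" for n
    proof (cases "n = 0")
      case True
      have "S 0 = coset (S 0) zero"
        using L' by (subst coset_zero) (auto simp: S_def invariant_subgyrogroup_def symmetric_invariant_def)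
      then show ?thesis using True zero_closed by blast
    next
      case False
      then show ?thesis using z(1)[of n] T_sub[of n] by (auto simp: S_def)
    qed
    show "\<forall>\<^sub>F n in sequentially. S n \<subseteq> W" if W: "openin X W \<and> S 0 \<subseteq> W" for W
    proof -
      \<comment> \<open>Compactness gives \<open>k\<close> with the part of \<open>T 0\<close> in
        the closure of \<open>V k\<close> inside \<open>W\<close>. Adding the complement of that
        closure to \<open>W\<close> yields an open set around all of \<open>T 0\<close>, hence
        around almost all \<open>T n\<close>; as \<open>S n\<close> ends up in \<open>V k\<close>,
        only the part in \<open>W\<close> remains.\<close>
      have "\<exists>k. T 0 \<inter> X closure_of V k \<subseteq> W"
      proof -
        have "compactin X (T 0 \<inter> X closure_of V k)" for k
          using closed_Int_compactin[OF closedin_closure_of L(2)] by (simp add: Int_commute)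
        moreover have "T 0 \<inter> X closure_of V i \<subseteq> T 0 \<inter> X closure_of V j \<or>
            T 0 \<inter> X closure_of V j \<subseteq> T 0 \<inter> X closure_of V i" for i j
          using V(4)[of i j] V(4)[of j i] closure_of_mono[of "V i" "V j" X] closure_of_mono[of "V j" "V i" X]
          by (meson Int_mono nle_le order_refl)
        moreover have "(\<Inter>k. T 0 \<inter> X closure_of V k) \<subseteq> W"
          using W by (auto simp: S_def L'_def M_cl)
        ultimately show ?thesis
          using compactin_chain_Inter_subset[OF haus, of UNIV "\<lambda>k. T 0 \<inter> X closure_of V k" W] W by simp
      qed
      then obtain k where k: "T 0 \<inter> X closure_of V k \<subseteq> W" ..
      define W' where "W' = W \<union> (topspace X - X closure_of V k)"
      have "openin X W'" unfolding W'_def using W by (intro openin_Un openin_diff) auto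
      moreover have "T 0 \<subseteq> W'" using k L_sub unfolding W'_def by blast
      ultimately have "\<forall>\<^sub>F n in sequentially. T n \<subseteq> W'" by (rule T_conv)
      moreover have "\<forall>\<^sub>F n in sequentially. Suc k \<le> n \<and> 0 < n"
        unfolding eventually_sequentially by (intro exI[of _ "Suc k"]) auto
      ultimately show ?thesis using T_meets[of "Suc k"]
      proof eventually_elim
        case (elim n)
        have zn: "z n \<in> V (Suc k)" using z(2) elim by blast
        have "S n \<subseteq> T n"
          by (rule S_sub)
        moreover have "S n \<subseteq> V k"
        proof
          fix y assume "y \<in> S n"
          then have y: "y \<in> coset (V (Suc k)) (z n)"
            using elim coset_mono[of L' "V (Suc k)" "z n"] by (auto simp: S_def L'_def M_def)
          have "z n \<in> coset (V (Suc k)) zero" using zn coset_zero[OF invariant_nbhdD(4)[OF V(1)]] by blast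
          then have "y \<in> coset (V k) zero"
            using coset_trans[OF V_sym zero_closed _ y V(3)] by blast
          then show "y \<in> V k" using coset_zero[OF invariant_nbhdD(4)[OF V(1)]] by blast
        qed
        ultimately show ?case using elim V_cl[of k] unfolding W'_def by blast
      qed
    qed
  qed
  moreover have "S \<le> T"
  proof (rule le_funI)
    fix n show "S n \<subseteq> T n" by (rule S_sub)
  qed
  moreover have "l \<notin> S 0" using U(2) V(2) by (auto simp: S_def L'_def M_def)
  ultimately show ?thesis using that by blast
qed

text \<open>A minimal refinement has a trivial subgyrogroup, as any other element could be removed
  by \<open>coset_sequence_refine\<close>. Its cosets then converge to the identity itself, and so
  do points chosen in them.\<close>

lemma coset_sequence_lift:
  assumes haus: "Hausdorff_space X" and T0: "coset_sequence T0"
  obtains x where "\<And>n. x n \<in> T0 n" "limitin X x zero sequentially"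
proof -
  define A where "A = {T. coset_sequence T \<and> T \<le> T0}"
  \<comment> \<open>The order is reversed so that the maximal element from Zorn's lemma is a minimal
    coset sequence.\<close>
  define P where "P S T \<longleftrightarrow> T \<le> S" for S T :: "nat \<Rightarrow> 'a set"
  have "\<exists>T\<in>A. \<forall>S\<in>A. P T S \<longrightarrow> S = T"
  proof (rule predicate_Zorn)
    show "partial_order_on A (relation_of P A)"
      by (rule partial_order_on_relation_ofI) (auto simp: P_def)
    fix C assume C: "C \<in> Chains (relation_of P A)"
    then have C_A: "C \<subseteq> A" and C_chain: "\<And>S T. \<lbrakk>S \<in> C; T \<in> C\<rbrakk> \<Longrightarrow> S \<le> T \<or> T \<le> S"
      by (auto simp: Chains_def relation_of_def P_def)
    show "\<exists>u\<in>A. \<forall>T\<in>C. P T u"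
    proof (cases "C = {}")
      case True
      then show ?thesis using T0 by (auto simp: A_def)
    next
      case False
      have "coset_sequence (\<lambda>n. \<Inter>T\<in>C. T n)"
        by (rule coset_sequence_INT[OF haus False _ C_chain]) (use C_A A_def in auto)
      moreover have "(\<lambda>n. \<Inter>T\<in>C. T n) \<le> T0"
        using C_A False by (force simp: A_def le_fun_def)
      moreover have "P T (\<lambda>n. \<Inter>T\<in>C. T n)" if "T \<in> C" for T
        using that by (auto simp: P_def le_fun_def)
      ultimately show ?thesis unfolding A_def by blast
    qed
  qed
  then obtain T where T: "coset_sequence T" "T \<le> T0" and minimal: "\<And>S. \<lbrakk>coset_sequence S; S \<le> T\<rbrakk> \<Longrightarrow> S = T"
    unfolding A_def P_def by (blast intro: order_trans)
  have "T 0 \<subseteq> {zero}"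
  proof
    fix l assume l: "l \<in> T 0"
    show "l \<in> {zero}"
    proof (rule ccontr)
      assume "l \<notin> {zero}"
      then obtain S where "coset_sequence S" "S \<le> T" "l \<notin> S 0"
        using coset_sequence_refine[OF haus T(1) l] by blast
      then show False using minimal l by blast
    qed
  qed
  then have T_zero: "T 0 = {zero}"
    using T(1) unfolding coset_sequence_def invariant_subgyrogroup_def by blast
  have "\<exists>x. x \<in> T n" for n using coset_sequence_nonempty[OF T(1)] by metis
  then obtain x where x: "\<And>n. x n \<in> T n" by metis
  have "limitin X x zero sequentially"
    unfolding limitin_def
  proof (intro conjI allI impI)
    fix W assume "openin X W \<and> zero \<in> W"
    then have "\<forall>\<^sub>F n in sequentially. T n \<subseteq> W"
      using T(1) T_zero unfolding coset_sequence_def by simp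
    then show "\<forall>\<^sub>F n in sequentially. x n \<in> W" by (rule eventually_mono) (use x in blast)
  qed (rule zero_closed)
  moreover have "x n \<in> T0 n" for n using x T(2) by (auto simp: le_fun_def)
  ultimately show ?thesis using that by blast
qed

section \<open>Feathered gyrogroups\<close>

text \<open>Translating by \<open>neg k\<close> for some \<open>k \<in> K\<close> moves the compact
  set onto the identity, and the translated countable family keeps its base property.\<close>

lemma feathered_obtains_compact_at_zero:
  assumes "feathered X"
  obtains K and P :: "nat \<Rightarrow> 'a set" where "compactin X K" "zero \<in> K"
    "\<And>n. openin X (P n)" "\<And>n. K \<subseteq> P n" "\<And>W. \<lbrakk>openin X W; K \<subseteq> W\<rbrakk> \<Longrightarrow> \<exists>n. P n \<subseteq> W"
proof -
  obtain K \<V> where K: "K \<noteq> {}" "compactin X K" and \<V>: "countable \<V>"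
    "\<forall>V\<in>\<V>. openin X V \<and> K \<subseteq> V" "\<forall>W. openin X W \<and> K \<subseteq> W \<longrightarrow> (\<exists>V\<in>\<V>. V \<subseteq> W)"
    using assms unfolding feathered_def by (elim exE conjE)
  have K_sub: "K \<subseteq> topspace X" using K(2) compactin_subset_topspace by blast
  obtain k where k: "k \<in> K" using K(1) by blast
  have kX: "k \<in> topspace X" "neg k \<in> topspace X" using k K_sub neg_closed by auto
  have "\<V> \<noteq> {}" using \<V>(3) K_sub openin_topspace by blast
  then have "from_nat_into \<V> n \<in> \<V>" for n by (rule from_nat_into)
  then have from_open: "openin X (from_nat_into \<V> n)" and from_K: "K \<subseteq> from_nat_into \<V> n" for n
    using \<V>(2) by auto
  define K' where "K' = (\<lambda>y. neg k \<oplus> y) ` K"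
  define P where "P n = {x \<in> topspace X. k \<oplus> x \<in> from_nat_into \<V> n}" for n
  show ?thesis
  proof
    show "compactin X K'"
      unfolding K'_def by (rule image_compactin[OF K(2) continuous_map_left_translation[OF kX(2)]])
    have "neg k \<oplus> k = zero" using kX by (simp add: neg_add)
    then show "zero \<in> K'" using k unfolding K'_def by force
    show "openin X (P n)" for n
      unfolding P_def using from_open kX by (intro openin_left_translation) auto
    show "K' \<subseteq> P n" for n
      using from_K[of n] K_sub kX by (auto simp: K'_def P_def add_closed add_neg_cancel subset_iff)
    show "\<exists>n. P n \<subseteq> W" if W: "openin X W" "K' \<subseteq> W" for W
    proof -
      have "openin X {y \<in> topspace X. neg k \<oplus> y \<in> W}"
        using W kX by (intro openin_left_translation)
      moreover have "K \<subseteq> {y \<in> topspace X. neg k \<oplus> y \<in> W}"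
        using W K_sub by (auto simp: K'_def)
      ultimately obtain V where V: "V \<in> \<V>" "V \<subseteq> {y \<in> topspace X. neg k \<oplus> y \<in> W}"
        using \<V>(3) by meson
      obtain n where n: "from_nat_into \<V> n = V" using from_nat_into_surj[OF \<V>(1) V(1)] by blast
      have "P n \<subseteq> W"
      proof
        fix x assume x: "x \<in> P n"
        then have "neg k \<oplus> (k \<oplus> x) \<in> W" using V n by (auto simp: P_def)
        then show "x \<in> W" using x kX neg_add_cancel by (simp add: P_def)
      qed
      then show ?thesis ..
    qed
  qed
qed

text \<open>The halving sequence \<open>U\<close> does two things at once: it shrinks into the sets
  \<open>P n\<close>, which makes its intersection \<open>L\<close> compact with base
  \<open>U\<close>, and it reserves \<open>y n \<in> U n\<close> with a whole coset of
  \<open>U (Suc n)\<close> in \<open>D n\<close>. The cosets of \<open>L\<close> through the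
  \<open>y n\<close> are then lifted to points.\<close>

lemma feathered_imp_meets_dense_open_sequences:
  assumes haus: "Hausdorff_space X" and feath: "feathered X"
  shows meets_dense_open_sequences
  unfolding meets_dense_open_sequences_def
proof (intro allI impI)
  fix D :: "nat \<Rightarrow> 'a set"
  assume D: "(\<forall>n. openin X (D n)) \<and> (\<forall>n. X closure_of D n = topspace X) \<and> decseq D"
  then have D_open: "openin X (D n)" for n by blast
  have D_meets: "D n \<inter> W \<noteq> {}" if "openin X W" "W \<noteq> {}" for n W
    using D that unfolding dense_intersects_open by blast
  obtain K and P :: "nat \<Rightarrow> 'a set" where K: "compactin X K" "zero \<in> K"
    and P: "\<And>n. openin X (P n)" "\<And>n. K \<subseteq> P n" "\<And>W. \<lbrakk>openin X W; K \<subseteq> W\<rbrakk> \<Longrightarrow> \<exists>n. P n \<subseteq> W"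
    using feathered_obtains_compact_at_zero[OF feath] by metis
  have "\<exists>U. \<forall>n. invariant_nbhd (U n) \<and>
      (U (Suc n) \<subseteq> U n \<inter> P n \<and> (\<forall>a\<in>U (Suc n). \<forall>b\<in>U (Suc n). a \<oplus> b \<in> U n) \<and>
        (\<exists>y\<in>U n. coset (U (Suc n)) y \<subseteq> D n))"
  proof (rule dependent_nat_choice)
    have "nbhd X zero (topspace X)" by (rule openin_imp_nbhd) (auto simp: zero_closed)
    then show "\<exists>U. invariant_nbhd U" by (rule invariant_nbhd_halving) blast
  next
    fix U n assume U: "invariant_nbhd U"
    obtain Q where Q: "openin X Q" "zero \<in> Q" "Q \<subseteq> U"
      using invariant_nbhdD(1)[OF U] unfolding nbhd_def by blast
    then obtain y where y: "y \<in> D n" "y \<in> Q" using D_meets[of Q n] by blast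
    have yX: "y \<in> topspace X" using y Q openin_subset by blast
    \<comment> \<open>Shrinking the next neighbourhood into \<open>N\<close> puts its entire coset
      through \<open>y\<close> into \<open>D n\<close>.\<close>
    define N where "N = {x \<in> topspace X. y \<oplus> x \<in> D n}"
    have "nbhd X zero N" unfolding N_def by (rule nbhd_left_translation[OF D_open y(1)])
    moreover have "nbhd X zero (P n)" by (rule openin_imp_nbhd[OF P(1)]) (use P(2) K(2) in blast)
    ultimately have V: "nbhd X zero (U \<inter> (P n \<inter> N))"
      using invariant_nbhdD(1)[OF U] by (intro nbhd_Int)
    obtain U' where U': "invariant_nbhd U'" "\<And>a b. \<lbrakk>a \<in> U'; b \<in> U'\<rbrakk> \<Longrightarrow> a \<oplus> b \<in> U \<inter> (P n \<inter> N)"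
      "U' \<subseteq> U \<inter> (P n \<inter> N)"
      using invariant_nbhd_halving[OF V] by metis
    have "coset U' y \<subseteq> D n"
    proof
      fix b assume b: "b \<in> coset U' y"
      then have "neg y \<oplus> b \<in> N" "b \<in> topspace X" using U'(3) by (auto simp: coset_def)
      then show "b \<in> D n" using add_neg_cancel[OF yX] by (simp add: N_def)
    qed
    then show "\<exists>U'. invariant_nbhd U' \<and>
      (U' \<subseteq> U \<inter> P n \<and> (\<forall>a\<in>U'. \<forall>b\<in>U'. a \<oplus> b \<in> U) \<and> (\<exists>y\<in>U. coset U' y \<subseteq> D n))"
      using U' y(2) Q(3) by (intro exI[of _ U']) blast
  qed
  then obtain U where U_all: "\<forall>n. invariant_nbhd (U n) \<and>
      (U (Suc n) \<subseteq> U n \<inter> P n \<and> (\<forall>a\<in>U (Suc n). \<forall>b\<in>U (Suc n). a \<oplus> b \<in> U n) \<and>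
        (\<exists>y\<in>U n. coset (U (Suc n)) y \<subseteq> D n))" by (rule exE)
  have U: "invariant_nbhd (U n)" and U_P: "U (Suc n) \<subseteq> P n"
    and U_add: "\<lbrakk>a \<in> U (Suc n); b \<in> U (Suc n)\<rbrakk> \<Longrightarrow> a \<oplus> b \<in> U n"
    and U_Suc: "U (Suc n) \<subseteq> U n"
    and U_y: "\<exists>y\<in>U n. coset (U (Suc n)) y \<subseteq> D n" for n a b
    using U_all by blast+
  obtain y where y: "\<And>n. y n \<in> U n" "\<And>n. coset (U (Suc n)) (y n) \<subseteq> D n" using U_y by metis
  have U_mono: "U n \<subseteq> U m" if "m \<le> n" for m n
    using lift_Suc_antimono_le[of U, OF U_Suc that] .
  note U_sub = invariant_nbhdD(4)[OF U] and U_sym = invariant_nbhdD(2)[OF U]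
  have yX: "y n \<in> topspace X" for n using y(1) U_sub by blast
  have U_cl: "U n \<subseteq> X closure_of U n" for n by (rule closure_of_subset[OF U_sub])
  have cl_U: "X closure_of U (Suc n) \<subseteq> U n" for n
    by (rule closure_of_subset_double[OF U U_add]) auto
  define L where "L = (\<Inter>n. U n)"
  have L: "invariant_subgyrogroup L"
    unfolding L_def using U_sym invariant_nbhdD(3)[OF U] U_add by (rule invariant_subgyrogroup_INT_halving)
  have L_cl: "L = (\<Inter>n. X closure_of U n)" using cl_U U_cl unfolding L_def by blast
  have L_U: "L \<subseteq> U n" for n by (auto simp: L_def)
  \<comment> \<open>Compactness of \<open>K\<close> handles the points of \<open>K\<close>; the open
    set \<open>W'\<close> then contains \<open>K\<close>, hence some \<open>P m\<close>. A late
    \<open>U\<close> lies both in \<open>P m\<close> and in the closure of \<open>U n\<close>, which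
    leaves only \<open>W\<close>.\<close>
  have L_base: "\<exists>n. U n \<subseteq> W" if W: "openin X W" "L \<subseteq> W" for W
  proof -
    have "\<exists>n\<in>UNIV. K \<inter> X closure_of U n \<subseteq> W"
    proof (rule compactin_chain_Inter_subset[OF haus])
      show "compactin X (K \<inter> X closure_of U n)" for n
        using closed_Int_compactin[OF closedin_closure_of K(1)] by (simp add: Int_commute)
      show "K \<inter> X closure_of U i \<subseteq> K \<inter> X closure_of U j \<or> K \<inter> X closure_of U j \<subseteq> K \<inter> X closure_of U i" for i j
        using closure_of_mono[OF U_mono, of i j] closure_of_mono[OF U_mono, of j i] by (meson Int_mono nle_le order_refl)
      show "(\<Inter>n\<in>UNIV. K \<inter> X closure_of U n) \<subseteq> W" using W(2) by (auto simp: L_cl)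
    qed (use W in auto)
    then obtain n where n: "K \<inter> X closure_of U n \<subseteq> W" by blast
    define W' where "W' = W \<union> (topspace X - X closure_of U n)"
    have "openin X W'" unfolding W'_def using W by (intro openin_Un openin_diff) auto
    moreover have "K \<subseteq> W'" using n compactin_subset_topspace[OF K(1)] unfolding W'_def by blast
    ultimately obtain m where "P m \<subseteq> W'" using P(3) by meson
    moreover have "U (max n (Suc m)) \<subseteq> P m" "U (max n (Suc m)) \<subseteq> X closure_of U n"
      using U_P[of m] U_mono[of "Suc m" "max n (Suc m)"] U_mono[of n "max n (Suc m)"] U_cl[of n] by auto
    ultimately have "U (max n (Suc m)) \<subseteq> W" unfolding W'_def by blast
    then show ?thesis ..
  qed
  \<comment> \<open>A point outside \<open>K\<close> is omitted by some \<open>P m\<close>, since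
    its complement is an open set containing \<open>K\<close>. As a closed subset of
    \<open>K\<close>, \<open>L\<close> is compact.\<close>
  have "L \<subseteq> K"
  proof
    fix p assume p: "p \<in> L"
    show "p \<in> K"
    proof (rule ccontr)
      assume "p \<notin> K"
      have "p \<in> topspace X" using p L_U[of 0] U_sub[of 0] by blast
      then have "openin X (topspace X - {p})"
        using closedin_Hausdorff_sing_eq[OF haus] by (intro openin_diff) auto
      moreover have "K \<subseteq> topspace X - {p}" using \<open>p \<notin> K\<close> compactin_subset_topspace[OF K(1)] by blast
      ultimately obtain m where "P m \<subseteq> topspace X - {p}" using P(3) by meson
      then show False using p L_U[of "Suc m"] U_P[of m] by blast
    qed
  qed
  moreover have "closedin X L" unfolding L_cl by (rule closedin_Inter) auto
  ultimately have L_comp: "compactin X L" using closed_compactin[OF K(1)] by blast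
  \<comment> \<open>Index 0 is reserved for the subgyrogroup, so the coset lying in
    \<open>D n\<close> sits at index \<open>Suc n\<close>; the final sequence undoes this
    shift.\<close>
  define T where "T n = (case n of 0 \<Rightarrow> L | Suc m \<Rightarrow> coset L (y m))" for n
  have T_0 [simp]: "T 0 = L" and T_Suc: "T (Suc m) = coset L (y m)" for m by (simp_all add: T_def)
  have "coset_sequence T"
    unfolding coset_sequence_def T_0
  proof (intro conjI allI impI)
    show "\<exists>c\<in>topspace X. T n = coset L c" for n
    proof (cases n)
      case 0
      have "L = coset L zero" using coset_zero[of L] compactin_subset_topspace[OF L_comp] by simp
      then show ?thesis using 0 zero_closed by auto
    next
      case (Suc m)
      then show ?thesis using yX T_Suc by blast
    qed
    show "\<forall>\<^sub>F n in sequentially. T n \<subseteq> W" if W: "openin X W \<and> L \<subseteq> W" for W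
    proof -
      obtain j where j: "U j \<subseteq> W" using L_base W by blast
      have "T n \<subseteq> W" if n: "n \<ge> Suc (Suc j)" for n
      proof -
        obtain m where m: "n = Suc m" "Suc j \<le> m" using n by (cases n) auto
        have "y m \<in> U (Suc j)" using y(1)[of m] U_mono[OF m(2)] by blast
        then have ym: "y m \<in> coset (U (Suc j)) zero" using coset_zero[OF U_sub] by blast
        have "coset L (y m) \<subseteq> U j"
        proof
          fix b assume "b \<in> coset L (y m)"
          then have "b \<in> coset (U (Suc j)) (y m)" using coset_mono[OF L_U] by blast
          then have "b \<in> coset (U j) zero"
            using coset_trans[OF U_sym zero_closed ym _ U_add] by blast
          then show "b \<in> U j" using coset_zero[OF U_sub] by blast
        qed
        then show ?thesis using j m T_Suc by blast
      qed
      then show ?thesis unfolding eventually_sequentially by blast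
    qed
  qed (fact L L_comp)+
  then obtain x where x: "\<And>n. x n \<in> T n" "limitin X x zero sequentially"
    using coset_sequence_lift[OF haus] by blast
  have "x (Suc n) \<in> D n" for n
    using x(1)[of "Suc n"] y(2)[of n] coset_mono[OF L_U[of "Suc n"], of "y n"] T_Suc by blast
  moreover have "limitin X (\<lambda>n. x (Suc n)) zero sequentially"
    using limitin_sequentially_offset[OF x(2), of 1] by simp
  ultimately show "\<exists>x. (\<forall>n. x n \<in> D n) \<and> limitin X x zero sequentially"
    by (intro exI[of _ "\<lambda>n. x (Suc n)"]) blast
qed

end

section \<open>Assembling the equivalences\<close>

theorem theorem3p16:
  fixes X :: "'a topology"
    and add :: "'a \<Rightarrow> 'a \<Rightarrow> 'a"
    and zero :: 'a
    and neg :: "'a \<Rightarrow> 'a"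
    and gyr :: "'a \<Rightarrow> 'a \<Rightarrow> 'a \<Rightarrow> 'a"
  assumes "strongly_topological_gyrogroup X add zero neg gyr"
    and "Hausdorff_space X"
  shows "(metrizable_space X \<longleftrightarrow> frechet_urysohn X \<and> countable_cs_star_character_at X zero) \<and>
         (metrizable_space X \<longleftrightarrow> frechet_urysohn X \<and> has_omega_omega_base X) \<and>
         (metrizable_space X \<longleftrightarrow> feathered X \<and> countable_cs_star_character_at X zero) \<and>
         (metrizable_space X \<longleftrightarrow> feathered X \<and> has_omega_omega_base X)"
proof -
  interpret strongly_topological_gyrogroup X add zero neg gyr by fact
  have metrizable: "metrizable_space X"
    if "frechet_urysohn X \<or> feathered X" "countable_cs_star_character_at X zero"
    using that frechet_urysohn_imp_meets_dense_open_sequences feathered_imp_meets_dense_open_sequences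
      ex_countable_base_at_zero metrizable_if_countable_base_at_zero assms(2) by blast
  have omega: "countable_cs_star_character_at X zero" if "has_omega_omega_base X"
  proof -
    obtain U :: "(nat \<Rightarrow> nat) \<Rightarrow> 'a set" where
      "nbhd_base X zero (range U)" "\<forall>\<alpha> \<beta>. \<alpha> \<le> \<beta> \<longrightarrow> U \<beta> \<subseteq> U \<alpha>"
      using \<open>has_omega_omega_base X\<close> zero_closed unfolding has_omega_omega_base_def by meson
    then show ?thesis
      by (intro omega_omega_base_imp_countable_cs_star_character[of X zero U]) simp_all
  qed
  have "frechet_urysohn X" "feathered X" "has_omega_omega_base X" "countable_cs_star_character_at X zero"
    if "metrizable_space X"
  proof -
    note fc = metrizable_imp_first_countable[OF that]
    show "frechet_urysohn X" by (rule first_countable_imp_frechet_urysohn[OF fc])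
    show "feathered X" using first_countable_imp_feathered[OF fc] zero_closed by blast
    show "has_omega_omega_base X" by (rule first_countable_imp_omega_omega_base[OF fc])
    show "countable_cs_star_character_at X zero"
      by (rule first_countable_imp_countable_cs_star_character[OF fc zero_closed])
  qed
  then show ?thesis using metrizable omega by blast
qed

end
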